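(* Let $d$ be an even integer, let $m\ge 1$ be an integer, and let $W_{2m+1}\in\mathsf{GC}_d$ be the wheel graph with $2m+1$ spokes (with any fixed ordering of its edges). Then there exists an element $U_{2m+1}\in\mathsf{GC}_d$ such that $$W_{2m+1}-\partial(U_{2m+1})\in\mathsf{GC}_d^{\mathrm{Me}},$$ where $\partial$ denotes the edge-contraction differential of $\mathsf{GC}_d$.
   Context: **Kontsevich graph complex, $d$ even.** Work over a field of characteristic $0$. For $d$ even, $\mathsf{GC}_d$ is the vector space spanned by finite connected graphs without loops (edges joining a vertex to itself), all of whose vertices have valence at least $3$, equipped with a bijective labelling of the $E$ edges by $0,1,\dots,E-1$. These are taken modulo the relation that if $\phi:\Gamma\to\Gamma'$ is an isomorphism of the underlying graphs inducing the permutation $\sigma$ of edge labels, then $\Gamma=\operatorname{sgn}(\sigma)\,\Gamma'$. Vertex labels and edge directions do not matter. In particular a graph with a multiple edge is $0$. (The homological grading depends on $d$ but plays no role in the statement.) **Differential.** $\partial\Gamma$ is the sum over all edges of $\Gamma$ of the graph obtained by contracting that edge (identifying its endpoints); contraction of the edge labelled $i$ in a graph with $E$ edges carries the sign $(-1)^{i+E}$, and the remaining edges are relabelled by preserving their relative order (labels larger than $i$ drop by $1$). Contractions producing a multiple edge or a loop contribute $0$. **Wheel.** $W_N$ is the graph with $N+1$ vertices consisting of a cycle on $N$ vertices (the rim) and one further vertex (the hub) joined by one edge to each rim vertex; it has $2N$ edges. **Low-valence subcomplex.** $\mathsf{GC}_d^{\mathrm{Me}}$ is the maximal subcomplex of $\mathsf{GC}_d$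 consisting of linear combinations of graphs all of whose vertices have valence $3$ or $4$; that is, the set of $x\in\mathsf{GC}_d$ such that both $x$ and $\partial x$ are linear combinations of graphs all of whose vertices have valence $3$ or $4$. *)

theory Defs
  imports
    Complex_Main
    "HOL-Library.Poly_Mapping"
    "HOL-Combinatorics.Permutations"
begin

section \<open>Generating graphs\<close>

text \<open>
  A multigraph is given by its vertex set and the list of its edges; the label of an edge is its
  position in the list. An edge joining distinct \<open>u\<close> and \<open>v\<close> is the set \<open>{u, v}\<close>, so edges carry no
  direction, and a multiple edge is a repeated entry of the list. Taking natural numbers as
  vertices is no restriction up to isomorphism.
\<close>

definition valence :: "nat set list \<Rightarrow> nat \<Rightarrow> nat" where
  "valence es v = length (filter (\<lambda>e. v \<in> e) es)"

definition loop_free :: "nat set list \<Rightarrow> bool" where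
  "loop_free es \<longleftrightarrow> (\<forall>e\<in>set es. card e = 2)"

definition is_gc_graph :: "nat set \<Rightarrow> nat set list \<Rightarrow> bool" where
  "is_gc_graph V es \<longleftrightarrow>
     finite V \<and> V \<noteq> {} \<and> (\<forall>e\<in>set es. e \<subseteq> V) \<and> loop_free es \<and>
     (\<forall>u\<in>V. \<forall>v\<in>V. (u, v) \<in> {(x, y). {x, y} \<in> set es}\<^sup>*) \<and>
     (\<forall>v\<in>V. 3 \<le> valence es v)"

typedef gc_graph = "{(V, es). is_gc_graph V es}"
proof
  have "(u, v) \<in> {(x, y). {x, y} = {0, Suc 0}}\<^sup>*" if "u \<in> {0, Suc 0}" "v \<in> {0, Suc 0}" for u v :: nat
    using that by (cases "u = v") (auto intro!: r_into_rtrancl)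
  then show "({0, 1}, [{0, 1}, {0, 1}, {0, 1}]) \<in> {(V, es). is_gc_graph V es}"
    by (auto simp: is_gc_graph_def loop_free_def valence_def)
qed

definition verts :: "gc_graph \<Rightarrow> nat set" where
  "verts G = fst (Rep_gc_graph G)"

definition edges :: "gc_graph \<Rightarrow> nat set list" where
  "edges G = snd (Rep_gc_graph G)"

lemma is_gc_graph_verts_edges: "is_gc_graph (verts G) (edges G)"
  using Rep_gc_graph[of G] by (auto simp: verts_def edges_def)

lemma gc_graph_exists:
  assumes "is_gc_graph V es"
  obtains G where "verts G = V" "edges G = es"
proof
  show "verts (Abs_gc_graph (V, es)) = V" "edges (Abs_gc_graph (V, es)) = es"
    using assms by (simp_all add: verts_def edges_def Abs_gc_graph_inverse)
qed

text \<open>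
  Isomorphisms of the underlying multigraphs: a bijection of the vertices together with a
  compatible bijection of the edges, the latter written as a permutation of the labels.
\<close>

definition gc_iso :: "(nat \<Rightarrow> nat) \<Rightarrow> (nat \<Rightarrow> nat) \<Rightarrow> gc_graph \<Rightarrow> gc_graph \<Rightarrow> bool" where
  "gc_iso f \<sigma> G H \<longleftrightarrow>
     bij_betw f (verts G) (verts H) \<and>
     length (edges G) = length (edges H) \<and>
     \<sigma> permutes {..<length (edges G)} \<and>
     (\<forall>i<length (edges G). edges H ! \<sigma> i = f ` (edges G ! i))"


section \<open>Edge contraction\<close>

definition merge :: "nat set \<Rightarrow> nat \<Rightarrow> nat" where
  "merge e x = (if x \<in> e then Min e else x)"

definition contract_edges :: "nat \<Rightarrow> nat set list \<Rightarrow> nat set list" where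
  "contract_edges i es = map ((`) (merge (es ! i))) (take i es @ drop (Suc i) es)"

text \<open>
  Contracting an edge that has a parallel edge turns the latter into a singleton, that is, into a
  loop. The contracted graph is therefore meaningful only under \<open>loop_free (contract_edges i (edges G))\<close>;
  see \<open>verts_contract\<close> and \<open>edges_contract\<close> below.
\<close>

definition contract :: "nat \<Rightarrow> gc_graph \<Rightarrow> gc_graph" where
  "contract i G = Abs_gc_graph (merge (edges G ! i) ` verts G, contract_edges i (edges G))"

lemma length_contract_edges: "i < length es \<Longrightarrow> length (contract_edges i es) = length es - 1"
  by (simp add: contract_edges_def)

lemma nth_contract_edges:
  assumes "i < length es" "j < length es - 1"
  shows "contract_edges i es ! j = merge (es ! i) ` (es ! (if j < i then j else Suc j))"
  using assms by (auto simp: contract_edges_def nth_append min_def)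

lemma filter_disj_length:
  "(\<And>x. x \<in> set xs \<Longrightarrow> \<not> (P x \<and> Q x)) \<Longrightarrow>
     length (filter (\<lambda>x. P x \<or> Q x) xs) = length (filter P xs) + length (filter Q xs)"
  by (induction xs) auto

lemma is_gc_graph_contract:
  assumes G: "is_gc_graph V es" and i: "i < length es" and lf: "loop_free (contract_edges i es)"
  shows "is_gc_graph (merge (es ! i) ` V) (contract_edges i es)"
proof -
  define e where "e = es ! i"
  define rest where "rest = take i es @ drop (Suc i) es"
  have ce: "contract_edges i es = map ((`) (merge e)) rest"
    by (simp add: contract_edges_def e_def rest_def)
  have es: "es = take i es @ e # drop (Suc i) es"
    using i by (simp add: e_def id_take_nth_drop)
  have set_es: "set es = insert e (set rest)"
    by (subst es) (auto simp: rest_def)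
  have val: "valence es w = valence rest w + (if w \<in> e then 1 else 0)" for w
    by (subst es) (simp add: rest_def valence_def)
  have eV: "e \<subseteq> V" and card_e: "card e = 2" and restV: "\<And>a. a \<in> set rest \<Longrightarrow> a \<subseteq> V"
    and card_rest: "\<And>a. a \<in> set rest \<Longrightarrow> card a = 2"
    using G by (auto simp: is_gc_graph_def loop_free_def set_es)
  obtain p q where pq: "e = {p, q}" "p < q"
    using card_e by (metis card_2_iff doubleton_eq_iff linorder_neqE_nat)
  have Min_e: "Min e = p" and pe: "p \<in> e" using pq by simp_all
  have ie: "x \<in> e \<longleftrightarrow> x = p \<or> x = q" for x using pq(1) by simp
  have mp: "merge e x = (if x \<in> e then p else x)" for x
    by (simp add: merge_def Min_e)
  have lf': "card (merge e ` a) = 2" if "a \<in> set rest" for a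
    using lf that by (auto simp: loop_free_def ce)
  have conn: "(merge e u, merge e v) \<in> {(x, y). {x, y} \<in> set (map ((`) (merge e)) rest)}\<^sup>*"
    if "(u, v) \<in> {(x, y). {x, y} \<in> set es}\<^sup>*" for u v
    using that
  proof (induction rule: rtrancl_induct)
    case base
    then show ?case by simp
  next
    case (step y z)
    from step(2) consider "{y, z} = e" | "{y, z} \<in> set rest" by (auto simp: set_es)
    then have "(merge e y, merge e z) \<in> {(x, y). {x, y} \<in> set (map ((`) (merge e)) rest)}\<^sup>*"
    proof cases
      case 1
      then have "merge e y = merge e z" by (auto simp: merge_def)
      then show ?thesis by simp
    next
      case 2
      have "{merge e y, merge e z} = merge e ` {y, z}" by simp
      also have "\<dots> \<in> set (map ((`) (merge e)) rest)" using 2 by (simp del: image_insert)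
      finally show ?thesis by (intro r_into_rtrancl) simp
    qed
    with step.IH show ?case by (rule rtrancl_trans)
  qed
  have valc: "3 \<le> valence (map ((`) (merge e)) rest) (merge e x)" if x: "x \<in> V" for x
  proof (cases "x \<in> e")
    case False
    have "x \<in> merge e ` a \<longleftrightarrow> x \<in> a" for a
      using False pe by (auto simp: mp image_iff)
    then have "valence (map ((`) (merge e)) rest) x = valence rest x"
      by (simp add: valence_def filter_map comp_def)
    then show ?thesis using False val[of x] G x by (auto simp: mp is_gc_graph_def)
  next
    case True
    have mem: "p \<in> merge e ` a \<longleftrightarrow> p \<in> a \<or> q \<in> a" for a
      by (auto simp: mp ie image_iff)
    have disj: "\<not> (p \<in> a \<and> q \<in> a)" if a: "a \<in> set rest" for a
    proof
      assume "p \<in> a \<and> q \<in> a"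
      then have "e \<subseteq> a" using pq by auto
      moreover have "finite a" using card_rest[OF a] by (simp add: card_ge_0_finite)
      ultimately have "a = e"
        using card_subset_eq[of a e] card_rest[OF a] card_e by simp
      then have "merge e ` a = {p}" using pe by (auto simp: mp image_iff)
      then show False using lf'[OF a] by simp
    qed
    have "valence (map ((`) (merge e)) rest) p = valence rest p + valence rest q"
      using disj by (simp add: valence_def filter_map comp_def mem filter_disj_length)
    moreover have "3 \<le> valence es p" "3 \<le> valence es q"
      using G eV pq by (auto simp: is_gc_graph_def)
    ultimately show ?thesis using val[of p] val[of q] True by (auto simp: mp ie)
  qed
  have V: "finite (merge e ` V)" "merge e ` V \<noteq> {}"
    using G by (auto simp: is_gc_graph_def)
  have sub: "\<forall>a\<in>set (map ((`) (merge e)) rest). a \<subseteq> merge e ` V"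
    using restV by auto
  show ?thesis
    unfolding is_gc_graph_def using V sub lf conn valc G
    unfolding ce e_def[symmetric] is_gc_graph_def by blast
qed

lemma Rep_contract:
  assumes "i < length (edges G)" "loop_free (contract_edges i (edges G))"
  shows "Rep_gc_graph (contract i G) =
    (merge (edges G ! i) ` verts G, contract_edges i (edges G))"
  unfolding contract_def
  by (subst Abs_gc_graph_inverse) (use is_gc_graph_contract[OF is_gc_graph_verts_edges assms] in auto)

lemma verts_contract:
  assumes "i < length (edges G)" "loop_free (contract_edges i (edges G))"
  shows "verts (contract i G) = merge (edges G ! i) ` verts G"
  by (simp add: verts_def Rep_contract[OF assms])

lemma edges_contract:
  assumes "i < length (edges G)" "loop_free (contract_edges i (edges G))"
  shows "edges (contract i G) = contract_edges i (edges G)"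
  by (simp add: edges_def Rep_contract[OF assms])


section \<open>The free vector space on the generating graphs\<close>

definition chain_scale :: "'k::field_char_0 \<Rightarrow> (gc_graph \<Rightarrow>\<^sub>0 'k) \<Rightarrow> (gc_graph \<Rightarrow>\<^sub>0 'k)" where
  "chain_scale c x = Poly_Mapping.map ((*) c) x"

lemma lookup_chain_scale [simp]:
  "Poly_Mapping.lookup (chain_scale c x) G = c * Poly_Mapping.lookup x G"
  by (simp add: chain_scale_def map.rep_eq when_def)

global_interpretation chain: vector_space chain_scale
  by unfold_locales (auto intro!: poly_mapping_eqI simp: lookup_add algebra_simps)

definition gc_relators :: "(gc_graph \<Rightarrow>\<^sub>0 'k::field_char_0) set" where
  "gc_relators =
     {Poly_Mapping.single G 1 - chain_scale (of_int (sign \<sigma>)) (Poly_Mapping.single H 1) | f \<sigma> G H.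
        gc_iso f \<sigma> G H}"

definition chain_boundary_graph :: "gc_graph \<Rightarrow> gc_graph \<Rightarrow>\<^sub>0 'k::field_char_0" where
  "chain_boundary_graph G =
     (\<Sum>i<length (edges G).
        if loop_free (contract_edges i (edges G)) \<and> distinct (contract_edges i (edges G))
        then chain_scale ((-1) ^ (i + length (edges G))) (Poly_Mapping.single (contract i G) 1)
        else 0)"

definition chain_boundary :: "(gc_graph \<Rightarrow>\<^sub>0 'k::field_char_0) \<Rightarrow> (gc_graph \<Rightarrow>\<^sub>0 'k)" where
  "chain_boundary x =
     (\<Sum>G\<in>Poly_Mapping.keys x. chain_scale (Poly_Mapping.lookup x G) (chain_boundary_graph G))"

lemma chain_boundary_superset:
  assumes "finite A" "Poly_Mapping.keys x \<subseteq> A"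
  shows "chain_boundary x =
    (\<Sum>G\<in>A. chain_scale (Poly_Mapping.lookup x G) (chain_boundary_graph G))"
  unfolding chain_boundary_def
  by (rule sum.mono_neutral_left) (use assms in \<open>auto simp: in_keys_iff\<close>)

lemma chain_boundary_add: "chain_boundary (x + y) = chain_boundary x + chain_boundary y"
proof -
  let ?A = "Poly_Mapping.keys x \<union> Poly_Mapping.keys y"
  have "Poly_Mapping.keys (x + y) \<subseteq> ?A" by (rule Poly_Mapping.keys_add)
  then show ?thesis
    by (simp add: chain_boundary_superset[of ?A] lookup_add chain.scale_left_distrib sum.distrib)
qed

lemma chain_boundary_scale: "chain_boundary (chain_scale c x) = chain_scale c (chain_boundary x)"
proof -
  have "Poly_Mapping.keys (chain_scale c x) \<subseteq> Poly_Mapping.keys x" by (auto simp: in_keys_iff)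
  then show ?thesis
    by (simp add: chain_boundary_superset[of "Poly_Mapping.keys x"] chain.scale_sum_right)
qed

lemma chain_boundary_linear: "Vector_Spaces.linear chain_scale chain_scale chain_boundary"
  by unfold_locales (simp_all add: chain_boundary_add chain_boundary_scale)

lemma chain_boundary_single: "chain_boundary (Poly_Mapping.single G 1) = chain_boundary_graph G"
  by (simp add: chain_boundary_def)


subsection \<open>The boundary respects the relators\<close>

definition cyc :: "nat \<Rightarrow> nat \<Rightarrow> nat \<Rightarrow> nat" where
  "cyc n i j = (if j < i \<or> n < j then j else if j = n then i else Suc j)"

lemma cyc_permutes_sign:
  assumes "i \<le> n"
  shows "cyc n i permutes {..n} \<and> sign (cyc n i) = (-1) ^ (n - i)"
  using assms
proof (induction i rule: inc_induct)
  case base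
  have "cyc n n = id" by (auto simp: cyc_def)
  then show ?case by (simp add: permutes_id del: id_apply flip: id_def)
next
  case (step i)
  have eq: "cyc n i = transpose i (Suc i) \<circ> cyc n (Suc i)"
    using step(2) by (auto simp: cyc_def transpose_def fun_eq_iff)
  have t: "transpose i (Suc i) permutes {..n}"
    using step(2) by (intro permutes_swap_id) auto
  have "sign (cyc n i) = sign (transpose i (Suc i)) * sign (cyc n (Suc i))"
    unfolding eq using step.IH
    by (intro sign_compose permutation_swap_id) (auto intro: permutation_permutes[THEN iffD2])
  also have "\<dots> = (-1) ^ (n - i)"
    using step.IH step(2) by (simp add: sign_swap_id Suc_diff_Suc[symmetric])
  finally show ?case
    using permutes_compose[of "cyc n (Suc i)" "{..n}" "transpose i (Suc i)"] step.IH t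
    unfolding eq by blast
qed

lemma induced_permutation:
  assumes s: "\<sigma> permutes {..<E}" and i: "i < E"
  obtains \<tau> where "\<tau> permutes {..<E - 1}"
    and "sign \<tau> = (-1) ^ (i + \<sigma> i) * sign \<sigma>"
    and "\<And>j. j < E - 1 \<Longrightarrow>
      (if \<tau> j < \<sigma> i then \<tau> j else Suc (\<tau> j)) = \<sigma> (if j < i then j else Suc j)"
proof -
  define n where "n = E - 1"
  have E: "{..<E} = {..n}" using i by (auto simp: n_def)
  have s': "\<sigma> permutes {..n}" using s E by simp
  have "\<sigma> i \<in> {..<E}" unfolding permutes_in_image[OF s] using i by simp
  then have le: "i \<le> n" "\<sigma> i \<le> n" using i by (auto simp: n_def)
  note c1 = cyc_permutes_sign[OF le(1)] and c2 = cyc_permutes_sign[OF le(2)]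
  define \<tau> where "\<tau> = inv (cyc n (\<sigma> i)) \<circ> (\<sigma> \<circ> cyc n i)"
  have p2: "inv (cyc n (\<sigma> i)) permutes {..n}" using c2 by (simp add: permutes_inv)
  have p3: "(\<sigma> \<circ> cyc n i) permutes {..n}" using c1 s' by (simp add: permutes_compose)
  have pt: "\<tau> permutes {..n}" unfolding \<tau>_def by (rule permutes_compose[OF p3 p2])
  have key: "cyc n (\<sigma> i) (\<tau> j) = \<sigma> (cyc n i j)" for j
    unfolding \<tau>_def using c2 by (simp add: permutes_inverses(1)[of _ "{..n}"])
  have perm: "permutation p" if "p permutes {..n}" for p
    using that by (auto intro: permutation_permutes[THEN iffD2])
  have inj: "inj (cyc n (\<sigma> i))" using c2 permutes_inj by blast
  have "cyc n (\<sigma> i) (\<tau> n) = cyc n (\<sigma> i) n" unfolding key using le by (simp add: cyc_def)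
  then have tn: "\<tau> n = n" using inj by (simp add: inj_eq)
  have pt': "\<tau> permutes {..<E - 1}"
    using pt
  proof (rule permutes_superset)
    fix x assume "x \<in> {..n} - {..<E - 1}"
    then have "x = n" by (auto simp: n_def)
    then show "\<tau> x = x" using tn by simp
  qed
  have "sign \<tau> = (-1) ^ (n - \<sigma> i) * (sign \<sigma> * (-1) ^ (n - i))"
    unfolding \<tau>_def using c1 c2 s' p2 p3 by (simp add: sign_compose sign_inverse perm)
  also have "(-1::int) ^ (n - \<sigma> i) = (-1) ^ (n + \<sigma> i)"
    using le by (simp add: minus_one_power_iff)
  also have "(-1::int) ^ (n - i) = (-1) ^ (n + i)"
    using le by (simp add: minus_one_power_iff)
  finally have sg: "sign \<tau> = (-1) ^ (i + \<sigma> i) * sign \<sigma>"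
    by (auto simp: minus_one_power_iff)
  show ?thesis
  proof (rule that[OF pt' sg])
    fix j assume j: "j < E - 1"
    have "\<tau> j < E - 1" using pt' j permutes_in_image[of \<tau> "{..<E - 1}" j] by simp
    then show "(if \<tau> j < \<sigma> i then \<tau> j else Suc (\<tau> j)) = \<sigma> (if j < i then j else Suc j)"
      using key[of j] j by (auto simp: cyc_def n_def split: if_splits)
  qed
qed

lemma relabel_loop_free_distinct:
  assumes len: "length es' = length es" and t: "\<tau> permutes {..<length es}"
    and inj: "inj_on g V" and sub: "\<And>e. e \<in> set es \<Longrightarrow> e \<subseteq> V"
    and nth: "\<And>j. j < length es \<Longrightarrow> es' ! \<tau> j = g ` (es ! j)"
  shows "loop_free es' \<longleftrightarrow> loop_free es" "distinct es' \<longleftrightarrow> distinct es"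
proof -
  have im: "\<tau> ` {..<length es} = {..<length es}" using t by (rule permutes_image)
  have es: "es = map ((!) es) [0..<length es]" by (simp add: map_nth)
  have "set es' = (!) es' ` {..<length es}" using len by (auto simp: set_conv_nth)
  also have "\<dots> = (\<lambda>j. es' ! \<tau> j) ` {..<length es}" by (subst im[symmetric]) (simp add: image_image)
  also have "\<dots> = (`) g ` set es" using nth by (auto simp: set_conv_nth image_iff)
  finally have set': "set es' = (`) g ` set es" .
  have "card (g ` e) = card e" if "e \<in> set es" for e
    using inj sub[OF that] by (meson card_image inj_on_subset)
  then show "loop_free es' \<longleftrightarrow> loop_free es" by (auto simp: loop_free_def set')
  have "inj_on ((`) g) (set es)"
    using inj sub by (meson PowI inj_on_image_Pow inj_on_subset subsetI)
  then have "card (set es') = card (set es)" by (simp add: set' card_image)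
  then show "distinct es' \<longleftrightarrow> distinct es"
    using len by (metis card_distinct distinct_card)
qed

lemma contract_iso:
  assumes iso: "gc_iso f \<sigma> G H" and i: "i < length (edges G)"
  shows "loop_free (contract_edges (\<sigma> i) (edges H)) \<longleftrightarrow> loop_free (contract_edges i (edges G))"
    and "distinct (contract_edges (\<sigma> i) (edges H)) \<longleftrightarrow> distinct (contract_edges i (edges G))"
    and "loop_free (contract_edges i (edges G)) \<Longrightarrow>
      \<exists>g \<tau>. gc_iso g \<tau> (contract i G) (contract (\<sigma> i) H) \<and> sign \<tau> = (-1) ^ (i + \<sigma> i) * sign \<sigma>"
proof -
  define e where "e = edges G ! i"
  define e' where "e' = edges H ! \<sigma> i"
  have bij: "bij_betw f (verts G) (verts H)" and len: "length (edges H) = length (edges G)"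
    and s: "\<sigma> permutes {..<length (edges G)}"
    and nth: "\<And>j. j < length (edges G) \<Longrightarrow> edges H ! \<sigma> j = f ` (edges G ! j)"
    using iso by (auto simp: gc_iso_def)
  have e'_eq: "e' = f ` e" using nth[OF i] by (simp add: e_def e'_def)
  have G: "is_gc_graph (verts G) (edges G)" by (rule is_gc_graph_verts_edges)
  have edgeV: "a \<subseteq> verts G" if "a \<in> set (edges G)" for a
    using G that by (auto simp: is_gc_graph_def)
  have e_in: "e \<in> set (edges G)" using i by (simp add: e_def)
  have card_e: "card e = 2" using G e_in by (auto simp: is_gc_graph_def loop_free_def)
  have fin: "finite e" "e \<noteq> {}" using card_e by (auto simp: card_ge_0_finite)
  have fin': "finite e'" "e' \<noteq> {}" using fin by (auto simp: e'_eq)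
  have Min: "Min e \<in> e" "Min e' \<in> e'" using fin fin' by auto
  have injf: "inj_on f (verts G)" using bij by (simp add: bij_betw_def)
  have mem: "f x \<in> e' \<longleftrightarrow> x \<in> e" if "x \<in> verts G" for x
    using that injf edgeV[OF e_in] by (auto simp: e'_eq inj_on_def)
  define g where "g = (\<lambda>y. merge e' (f y))"
  have gm: "g (merge e x) = merge e' (f x)" if "x \<in> verts G" for x
    using that mem[OF that] Min edgeV[OF e_in] mem[of "Min e"] by (auto simp: g_def merge_def)
  have img: "g ` merge e ` verts G = merge e' ` verts H"
  proof -
    have "g ` merge e ` verts G = merge e' ` f ` verts G"
      using gm by (auto simp: image_image intro!: image_cong)
    then show ?thesis using bij by (simp add: bij_betw_def)
  qed
  have injg: "inj_on g (merge e ` verts G)"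
  proof (rule inj_onI)
    fix a b assume "a \<in> merge e ` verts G" "b \<in> merge e ` verts G" and eq: "g a = g b"
    then obtain x y where xy: "x \<in> verts G" "y \<in> verts G" "a = merge e x" "b = merge e y" by auto
    have "merge e' (f x) = merge e' (f y)" using eq gm xy by simp
    then have "f x = f y \<or> f x \<in> e' \<and> f y \<in> e'"
      using Min by (auto simp: merge_def split: if_splits)
    then show "a = b"
      using xy mem injf by (auto simp: merge_def inj_on_def)
  qed
  have si: "\<sigma> i < length (edges H)"
    using s i len permutes_in_image[OF s, of i] by simp
  obtain \<tau> where tp: "\<tau> permutes {..<length (edges G) - 1}"
    and ts: "sign \<tau> = (-1) ^ (i + \<sigma> i) * sign \<sigma>"
    and tk: "\<And>j. j < length (edges G) - 1 \<Longrightarrow>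
      (if \<tau> j < \<sigma> i then \<tau> j else Suc (\<tau> j)) = \<sigma> (if j < i then j else Suc j)"
    using induced_permutation[OF s i] by blast
  have lenc: "length (contract_edges i (edges G)) = length (edges G) - 1"
    "length (contract_edges (\<sigma> i) (edges H)) = length (edges G) - 1"
    using i si len by (simp_all add: length_contract_edges)
  have nthc: "contract_edges (\<sigma> i) (edges H) ! \<tau> j = g ` (contract_edges i (edges G) ! j)"
    if j: "j < length (edges G) - 1" for j
  proof -
    let ?k = "if j < i then j else Suc j"
    have k: "?k < length (edges G)" using j by auto
    have tj: "\<tau> j < length (edges H) - 1"
      using tp j len permutes_in_image[of \<tau> "{..<length (edges G) - 1}" j] by simp
    have "contract_edges (\<sigma> i) (edges H) ! \<tau> j = merge e' ` (edges H ! \<sigma> ?k)"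
      using nth_contract_edges[OF si tj] tk[OF j] by (simp add: e'_def)
    also have "\<dots> = (\<lambda>x. merge e' (f x)) ` (edges G ! ?k)"
      using nth[OF k] by (simp add: image_image)
    also have "\<dots> = (\<lambda>x. g (merge e x)) ` (edges G ! ?k)"
      using edgeV[OF nth_mem[OF k]] gm by (intro image_cong) auto
    also have "\<dots> = g ` (contract_edges i (edges G) ! j)"
      using nth_contract_edges[OF i j] by (simp add: e_def image_image)
    finally show ?thesis .
  qed
  have subc: "a \<subseteq> merge e ` verts G" if "a \<in> set (contract_edges i (edges G))" for a
  proof -
    from that obtain b where "b \<in> set (edges G)" "a = merge e ` b"
      by (auto simp: contract_edges_def e_def dest: in_set_takeD in_set_dropD)
    then show ?thesis using edgeV by blast
  qed
  have rel: "length (contract_edges (\<sigma> i) (edges H)) = length (contract_edges i (edges G))"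
    "\<tau> permutes {..<length (contract_edges i (edges G))}"
    "\<And>j. j < length (contract_edges i (edges G)) \<Longrightarrow>
      contract_edges (\<sigma> i) (edges H) ! \<tau> j = g ` (contract_edges i (edges G) ! j)"
    using lenc tp nthc by simp_all
  show lf: "loop_free (contract_edges (\<sigma> i) (edges H)) \<longleftrightarrow> loop_free (contract_edges i (edges G))"
    by (rule relabel_loop_free_distinct(1)[OF rel(1,2) injg subc rel(3)])
  show "distinct (contract_edges (\<sigma> i) (edges H)) \<longleftrightarrow> distinct (contract_edges i (edges G))"
    by (rule relabel_loop_free_distinct(2)[OF rel(1,2) injg subc rel(3)])
  assume lfG: "loop_free (contract_edges i (edges G))"
  then have lfH: "loop_free (contract_edges (\<sigma> i) (edges H))" using lf by simp
  have "gc_iso g \<tau> (contract i G) (contract (\<sigma> i) H)"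
    unfolding gc_iso_def verts_contract[OF i lfG] verts_contract[OF si lfH]
      edges_contract[OF i lfG] edges_contract[OF si lfH]
    using injg img rel by (auto simp: bij_betw_def e_def e'_def)
  with ts show "\<exists>g \<tau>. gc_iso g \<tau> (contract i G) (contract (\<sigma> i) H) \<and>
      sign \<tau> = (-1) ^ (i + \<sigma> i) * sign \<sigma>"
    by blast
qed

lemma chain_boundary_relator:
  assumes iso: "gc_iso f \<sigma> G H"
  shows "chain_boundary_graph G - chain_scale (of_int (sign \<sigma>)) (chain_boundary_graph H)
    \<in> chain.span (gc_relators :: (gc_graph \<Rightarrow>\<^sub>0 'k::field_char_0) set)"
proof -
  let ?E = "length (edges G)"
  define t :: "gc_graph \<Rightarrow> nat \<Rightarrow> gc_graph \<Rightarrow>\<^sub>0 'k" where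
    "t K i = (if loop_free (contract_edges i (edges K)) \<and> distinct (contract_edges i (edges K))
        then chain_scale ((-1) ^ (i + length (edges K))) (Poly_Mapping.single (contract i K) 1)
        else 0)" for K i
  have len: "length (edges H) = ?E" and s: "\<sigma> permutes {..<?E}"
    using iso by (auto simp: gc_iso_def)
  have "chain_boundary_graph H = (\<Sum>i<?E. t H i)"
    by (simp add: chain_boundary_graph_def t_def len)
  also have "\<dots> = (\<Sum>i<?E. t H (\<sigma> i))"
    using sum.permute[OF s, of "t H"] by (simp add: comp_def)
  finally have bH: "chain_boundary_graph H = (\<Sum>i<?E. t H (\<sigma> i))" .
  have bG: "chain_boundary_graph G = (\<Sum>i<?E. t G i)"
    by (simp add: chain_boundary_graph_def t_def)
  have "t G i - chain_scale (of_int (sign \<sigma>)) (t H (\<sigma> i)) \<in> chain.span gc_relators"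
    if i: "i < ?E" for i
  proof (cases "loop_free (contract_edges i (edges G)) \<and> distinct (contract_edges i (edges G))")
    case False
    then have "t G i = 0" "t H (\<sigma> i) = 0"
      using contract_iso(1,2)[OF iso i] by (auto simp: t_def)
    then show ?thesis by (simp add: chain.span_zero)
  next
    case True
    then obtain g \<tau> where g: "gc_iso g \<tau> (contract i G) (contract (\<sigma> i) H)"
      and ts: "sign \<tau> = (-1) ^ (i + \<sigma> i) * sign \<sigma>"
      using contract_iso(3)[OF iso i] by blast
    have rel: "Poly_Mapping.single (contract i G) 1 -
        chain_scale (of_int (sign \<tau>)) (Poly_Mapping.single (contract (\<sigma> i) H) 1)
        \<in> chain.span (gc_relators :: (gc_graph \<Rightarrow>\<^sub>0 'k) set)"
      using g by (intro chain.span_base) (auto simp: gc_relators_def)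
    have sgn: "(-1) ^ (i + ?E) * of_int (sign \<tau>) = (of_int (sign \<sigma>) * (-1) ^ (\<sigma> i + ?E) :: 'k)"
      by (auto simp: ts minus_one_power_iff)
    have "t G i - chain_scale (of_int (sign \<sigma>)) (t H (\<sigma> i)) =
        chain_scale ((-1) ^ (i + ?E)) (Poly_Mapping.single (contract i G) 1 -
          chain_scale (of_int (sign \<tau>)) (Poly_Mapping.single (contract (\<sigma> i) H) 1))"
      using True contract_iso(1,2)[OF iso i]
      by (simp add: t_def len chain.scale_right_diff_distrib sgn)
    then show ?thesis using chain.span_scale[OF rel] by simp
  qed
  then show ?thesis
    unfolding bG bH chain.scale_sum_right sum_subtractf[symmetric] by (intro chain.span_sum) auto
qed

lemma chain_boundary_span:
  assumes "x \<in> chain.span gc_relators"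
  shows "chain_boundary x \<in> chain.span (gc_relators :: (gc_graph \<Rightarrow>\<^sub>0 'k::field_char_0) set)"
proof -
  interpret b: Vector_Spaces.linear chain_scale chain_scale
    "chain_boundary :: (gc_graph \<Rightarrow>\<^sub>0 'k) \<Rightarrow> (gc_graph \<Rightarrow>\<^sub>0 'k)"
    by (rule chain_boundary_linear)
  have "chain_boundary r \<in> chain.span gc_relators" if "r \<in> gc_relators" for r :: "gc_graph \<Rightarrow>\<^sub>0 'k"
    using that chain_boundary_relator
    by (auto simp: gc_relators_def b.diff b.scale chain_boundary_single)
  then have "chain_boundary ` chain.span gc_relators \<subseteq> chain.span (gc_relators :: (gc_graph \<Rightarrow>\<^sub>0 'k) set)"
    unfolding b.span_image[symmetric]
    by (intro chain.span_minimal chain.subspace_span) auto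
  then show ?thesis using assms by blast
qed


section \<open>The graph complex\<close>

text \<open>
  \<open>'k gc\<close> is the vector space underlying \<open>GC_d\<close> over the field \<open>'k\<close>. It is the same for every even
  \<open>d\<close>: only the grading, which is not recorded, depends on \<open>d\<close>.
\<close>

definition gc_rel :: "(gc_graph \<Rightarrow>\<^sub>0 'k::field_char_0) \<Rightarrow> (gc_graph \<Rightarrow>\<^sub>0 'k) \<Rightarrow> bool" where
  "gc_rel x y \<longleftrightarrow> x - y \<in> chain.span gc_relators"

lemma gc_rel_equivp: "equivp (gc_rel :: (gc_graph \<Rightarrow>\<^sub>0 'k::field_char_0) \<Rightarrow> _)"
proof (rule equivpI)
  show "reflp (gc_rel :: (gc_graph \<Rightarrow>\<^sub>0 'k) \<Rightarrow> _)"
    by (auto intro!: reflpI simp: gc_rel_def chain.span_zero)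
  show "symp (gc_rel :: (gc_graph \<Rightarrow>\<^sub>0 'k) \<Rightarrow> _)"
    by (intro sympI) (metis gc_rel_def chain.span_neg minus_diff_eq)
  show "transp (gc_rel :: (gc_graph \<Rightarrow>\<^sub>0 'k) \<Rightarrow> _)"
    proof (rule transpI)
    fix x y z :: "gc_graph \<Rightarrow>\<^sub>0 'k"
    assume "gc_rel x y" "gc_rel y z"
    then have "(x - y) + (y - z) \<in> chain.span gc_relators"
      unfolding gc_rel_def by (rule chain.span_add)
    then show "gc_rel x z" by (simp add: gc_rel_def)
  qed
qed

quotient_type (overloaded) 'k gc = "gc_graph \<Rightarrow>\<^sub>0 'k::field_char_0" / gc_rel
  by (rule gc_rel_equivp)

instantiation gc :: (field_char_0) ab_group_add
begin

lift_definition zero_gc :: "'a gc" is 0 .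

lift_definition plus_gc :: "'a gc \<Rightarrow> 'a gc \<Rightarrow> 'a gc" is "(+)"
  unfolding gc_rel_def by (metis add_diff_add chain.span_add)

lift_definition uminus_gc :: "'a gc \<Rightarrow> 'a gc" is uminus
  unfolding gc_rel_def by (metis chain.span_neg minus_diff_minus)

lift_definition minus_gc :: "'a gc \<Rightarrow> 'a gc \<Rightarrow> 'a gc" is "(-)"
proof -
  fix x x' y y' :: "gc_graph \<Rightarrow>\<^sub>0 'a"
  assume "gc_rel x x'" "gc_rel y y'"
  then have "(x - x') - (y - y') \<in> chain.span gc_relators"
    unfolding gc_rel_def by (rule chain.span_diff)
  then show "gc_rel (x - y) (x' - y')" by (simp add: gc_rel_def algebra_simps)
qed

instance
  by standard (transfer, simp add: gc_rel_def chain.span_zero algebra_simps)+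

end

lift_definition gc_scale :: "'k::field_char_0 \<Rightarrow> 'k gc \<Rightarrow> 'k gc" is chain_scale
  unfolding gc_rel_def by (metis chain.scale_right_diff_distrib chain.span_scale)

global_interpretation gc: vector_space gc_scale
  by unfold_locales
    (transfer, simp add: gc_rel_def chain.span_zero chain.scale_right_distrib chain.scale_left_distrib)+

lift_definition gc_class :: "gc_graph \<Rightarrow> 'k::field_char_0 gc" is "\<lambda>G. Poly_Mapping.single G 1" .

lift_definition gc_boundary :: "'k::field_char_0 gc \<Rightarrow> 'k gc" (\<open>\<partial>\<close>) is chain_boundary
proof -
  fix x y :: "gc_graph \<Rightarrow>\<^sub>0 'k"
  interpret b: Vector_Spaces.linear chain_scale chain_scale
    "chain_boundary :: (gc_graph \<Rightarrow>\<^sub>0 'k) \<Rightarrow> (gc_graph \<Rightarrow>\<^sub>0 'k)"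
    by (rule chain_boundary_linear)
  show "gc_rel x y \<Longrightarrow> gc_rel (chain_boundary x) (chain_boundary y)"
    using chain_boundary_span[of "x - y"] by (simp add: gc_rel_def b.diff)
qed

lemma gc_class_iso: "gc_iso f \<sigma> G H \<Longrightarrow> gc_class G = gc_scale (of_int (sign \<sigma>)) (gc_class H)"
  by transfer (auto simp: gc_rel_def gc_relators_def intro!: chain.span_base)

lemma gc_boundary_linear: "Vector_Spaces.linear gc_scale gc_scale \<partial>"
  by unfold_locales
    (transfer, simp add: gc_rel_def chain.span_zero chain_boundary_add chain_boundary_scale)+

lemma gc_span_classes: "gc.span (range gc_class) = (UNIV :: 'k::field_char_0 gc set)"
proof -
  have sum': "abs_gc (\<Sum>G\<in>A. chain_scale (c G) (Poly_Mapping.single G 1)) =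
      (\<Sum>G\<in>A. gc_scale (c G) (gc_class G))" if "finite A" for A and c :: "gc_graph \<Rightarrow> 'k"
    using that by (induction A)
      (simp_all add: zero_gc.abs_eq plus_gc.abs_eq[symmetric] gc_scale.abs_eq gc_class.abs_eq)
  have "z \<in> gc.span (range gc_class)" for z :: "'k gc"
  proof -
    obtain x where z: "z = abs_gc x" by (metis Quotient3_abs_rep Quotient3_gc)
    have "x = (\<Sum>G\<in>Poly_Mapping.keys x.
        chain_scale (Poly_Mapping.lookup x G) (Poly_Mapping.single G 1))"
      by (rule poly_mapping_eqI)
        (auto simp: lookup_sum lookup_single when_def if_distrib in_keys_iff
          sum.delta cong: if_cong)
    then have "z = (\<Sum>G\<in>Poly_Mapping.keys x. gc_scale (Poly_Mapping.lookup x G) (gc_class G))"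
      using z sum' by (metis finite_keys)
    then show ?thesis
      by (simp only:) (intro gc.span_sum gc.span_scale gc.span_base rangeI)
  qed
  then show ?thesis by auto
qed

lemma gc_boundary_class:
  "\<partial> (gc_class G :: 'k::field_char_0 gc) =
     (\<Sum>i<length (edges G).
        if loop_free (contract_edges i (edges G)) \<and> distinct (contract_edges i (edges G))
        then gc_scale ((-1) ^ (i + length (edges G))) (gc_class (contract i G))
        else 0)"
proof -
  have sum': "abs_gc (\<Sum>i\<in>A. x i) = (\<Sum>i\<in>A. abs_gc (x i))" if "finite A"
    for A :: "nat set" and x :: "nat \<Rightarrow> gc_graph \<Rightarrow>\<^sub>0 'k"
    using that by (induction A) (simp_all add: zero_gc.abs_eq plus_gc.abs_eq[symmetric])
  show ?thesis
    unfolding gc_class.abs_eq gc_boundary.abs_eq chain_boundary_single chain_boundary_graph_def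
      sum'[OF finite_lessThan]
    by (intro sum.cong) (simp_all add: gc_scale.abs_eq zero_gc.abs_eq)
qed

lemma gc_class_multiple_edge:
  assumes "\<not> distinct (edges G)"
  shows "gc_class G = (0 :: 'k::field_char_0 gc)"
proof -
  obtain i j where ij: "i < length (edges G)" "j < length (edges G)" "i \<noteq> j"
    "edges G ! i = edges G ! j"
    using assms by (auto simp: distinct_conv_nth)
  have "gc_iso id (transpose i j) G G"
    using ij by (auto simp: gc_iso_def permutes_swap_id transpose_def)
  from gc_class_iso[OF this] have "gc_class G = - (gc_class G :: 'k gc)"
    using ij(3) by (simp add: sign_swap_id)
  then have "gc_scale (1 + 1) (gc_class G) = (0 :: 'k gc)"
    by (simp only: gc.scale_left_distrib gc.scale_one) (simp add: eq_neg_iff_add_eq_0)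
  then show ?thesis by simp
qed

definition low_valence :: "gc_graph \<Rightarrow> bool" where
  "low_valence G \<longleftrightarrow> (\<forall>v\<in>verts G. valence (edges G) v \<in> {3, 4})"

definition GC_Me :: "'k::field_char_0 gc set" where
  "GC_Me = {x. x \<in> gc.span (gc_class ` Collect low_valence) \<and>
               \<partial> x \<in> gc.span (gc_class ` Collect low_valence)}"


section \<open>Wheels\<close>

text \<open>
  The rim vertices are \<open>0, \<dots>, N - 1\<close> and the hub is \<open>N\<close>. The predicate holds for the wheel with
  any ordering of its edges.
\<close>

definition wheel_edges :: "nat \<Rightarrow> nat set set" where
  "wheel_edges N = (\<lambda>i. {i, Suc i mod N}) ` {..<N} \<union> (\<lambda>i. {i, N}) ` {..<N}"

definition is_wheel :: "nat \<Rightarrow> gc_graph \<Rightarrow> bool" where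
  "is_wheel N W \<longleftrightarrow> verts W = {..N} \<and> distinct (edges W) \<and> set (edges W) = wheel_edges N"

lemma wheel_edges_facts:
  assumes N: "3 \<le> N"
  shows "card (wheel_edges N) = 2 * N"
    and "\<And>e. e \<in> wheel_edges N \<Longrightarrow> e \<subseteq> {..N} \<and> card e = 2"
proof -
  have succ: "Suc i mod N = (if Suc i = N then 0 else Suc i)" if "i < N" for i
    using that by simp
  have rim: "inj_on (\<lambda>i. {i, Suc i mod N}) {..<N}"
    by (rule inj_onI) (use N in \<open>auto simp: succ doubleton_eq_iff split: if_splits\<close>)
  have spokes: "inj_on (\<lambda>i. {i, N}) {..<N}"
    by (rule inj_onI) (auto simp: doubleton_eq_iff)
  have disj: "(\<lambda>i. {i, Suc i mod N}) ` {..<N} \<inter> (\<lambda>i. {i, N}) ` {..<N} = {}"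
    using N by (auto simp: succ doubleton_eq_iff split: if_splits)
  show "card (wheel_edges N) = 2 * N"
    unfolding wheel_edges_def using rim spokes disj by (simp add: card_Un_disjoint card_image)
  show "e \<subseteq> {..N} \<and> card e = 2" if "e \<in> wheel_edges N" for e
    using that N by (auto simp: wheel_edges_def succ card_insert_if split: if_splits)
qed

lemma wheel_exists:
  assumes N: "3 \<le> N" and es: "distinct es" "set es = wheel_edges N"
  obtains W where "is_wheel N W" "edges W = es" "length es = 2 * N"
proof -
  let ?R = "{(x, y). {x, y} \<in> set es}"
  have spoke: "{u, N} \<in> set es" "{N, u} \<in> set es" if "u < N" for u
    using that by (auto simp: es wheel_edges_def insert_commute)
  have "(u, N) \<in> ?R\<^sup>*" "(N, u) \<in> ?R\<^sup>*" if "u \<le> N" for u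
    using spoke[of u] that by (cases "u = N"; auto intro: r_into_rtrancl)+
  then have conn: "(u, v) \<in> ?R\<^sup>*" if "u \<le> N" "v \<le> N" for u v
    by (rule rtrancl_trans) (use that in auto)
  have val: "3 \<le> valence es v" if v: "v \<le> N" for v
  proof -
    have "valence es v = card {e \<in> set es. v \<in> e}"
      unfolding valence_def using es(1) by (metis distinct_card distinct_filter set_filter)
    moreover obtain A where "A \<subseteq> {e \<in> set es. v \<in> e}" "3 \<le> card A"
    proof (cases "v = N")
      case True
      have "inj_on (\<lambda>i. {i, N}) {..<N}" by (rule inj_onI) (auto simp: doubleton_eq_iff)
      then have "card ((\<lambda>i. {i, N}) ` {..<N}) = N" by (simp add: card_image)
      then show ?thesis using N spoke True
        by (intro that[of "(\<lambda>i. {i, N}) ` {..<N}"]) auto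
    next
      case False
      define p where "p = (if v = 0 then N - 1 else v - 1)"
      define s where "s = (if Suc v = N then 0 else Suc v)"
      have vN: "v < N" using v False by simp
      have ps: "p < N" "s < N" "p \<noteq> s" "p \<noteq> v" "s \<noteq> v" "Suc p mod N = v" "Suc v mod N = s"
        using N vN by (auto simp: p_def s_def split: if_splits)
      have "{v, s} \<in> set es" "{p, v} \<in> set es"
        using ps vN by (auto simp: es wheel_edges_def image_iff)
      moreover have "card {{v, N}, {v, s}, {p, v}} = 3"
        using ps vN by (auto simp: card_insert_if doubleton_eq_iff)
      ultimately show ?thesis using spoke[OF vN]
        by (intro that[of "{{v, N}, {v, s}, {p, v}}"]) auto
    qed
    moreover have "card A \<le> card {e \<in> set es. v \<in> e}"
      using calculation(2) by (intro card_mono) auto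
    ultimately show ?thesis by simp
  qed
  have "is_gc_graph {..N} es"
    unfolding is_gc_graph_def loop_free_def
    using wheel_edges_facts(2)[OF N] conn val by (auto simp: es(2))
  then obtain W where "verts W = {..N}" "edges W = es" by (rule gc_graph_exists)
  moreover have "length es = 2 * N"
    using es wheel_edges_facts(1)[OF N] by (metis distinct_card)
  ultimately show ?thesis using es by (intro that[of W]) (auto simp: is_wheel_def)
qed

end

theory Submission
  imports Defs
begin

text \<open>
  Replace the hub of the wheel by a path whose first vertex \<open>0\<close> is joined to two adjacent rim
  vertices, whose inner vertices are each joined to two adjacent rim vertices lying on one of the two
  sides of the path, as prescribed by a word \<open>w\<close> over \<open>bool\<close>, and whose last vertex, the cap, is
  joined to the \<open>n\<close> remaining rim vertices; path vertices that follow each other on the same side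
  share the rim vertex between them, except next to the cap. Almost every edge of this graph \<open>U(w, n)\<close> lies in a triangle, so
  its contraction produces a double edge and contributes \<open>0\<close> to the boundary. The exceptions are the
  path edge at the cap, the two rim edges on either side of the fan of the cap, and the path edges
  between unequal letters of \<open>w\<close>. The latter cancel in the sum over all words of a given length,
  because interchanging two adjacent letters changes the sign. Contracting the path edge at the cap
  of \<open>U(w x, n)\<close> gives, up to sign, the same graph as contracting the rim edge on side \<open>x\<close> of
  \<open>U(w, n + 2)\<close>. Hence the alternating sum over the word length telescopes: at one end stands
  the wheel, at the other end graphs whose cap has valence \<open>4\<close>, like all the other vertices at most.
\<close>

section \<open>Classes of edge lists\<close>

text \<open>Lists that are not graphs of the complex get class \<open>0\<close>, so contractions can
  be taken without side conditions. The vertex set is recovered from the edges, since the valence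
  condition leaves no isolated vertices.\<close>

definition list_class :: "nat set list \<Rightarrow> 'k::field_char_0 gc" where
  "list_class es =
     (if is_gc_graph (\<Union>(set es)) es then gc_class (Abs_gc_graph (\<Union>(set es), es)) else 0)"

lemma is_gc_graph_verts:
  assumes "is_gc_graph V es"
  shows "V = \<Union>(set es)"
proof -
  have "\<exists>e\<in>set es. v \<in> e" if "v \<in> V" for v
  proof -
    have "filter (\<lambda>e. v \<in> e) es \<noteq> []"
      using assms that by (auto simp: is_gc_graph_def valence_def)
    then show ?thesis by (auto simp: filter_empty_conv)
  qed
  then show ?thesis using assms by (auto simp: is_gc_graph_def)
qed

lemma list_class_edges: "list_class (edges G) = gc_class G"
proof -
  have "is_gc_graph (verts G) (edges G)" by (rule is_gc_graph_verts_edges)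
  moreover from this have V: "verts G = \<Union>(set (edges G))" by (rule is_gc_graph_verts)
  moreover have "Abs_gc_graph (verts G, edges G) = G"
    by (simp add: verts_def edges_def Rep_gc_graph_inverse)
  ultimately show ?thesis by (simp add: list_class_def)
qed

text \<open>A loop triggers the default value of \<open>list_class\<close>; a repeated edge kills
  the class because exchanging the two copies is odd.\<close>

lemma list_class_eq_0: "\<not> (loop_free es \<and> distinct es) \<Longrightarrow> list_class es = 0"
  by (metis gc_class_multiple_edge gc_graph_exists is_gc_graph_def list_class_def list_class_edges)

text \<open>The case distinction of \<open>gc_boundary_class\<close> disappears because the excluded
  contractions already have class \<open>0\<close>.\<close>

lemma gc_boundary_list_class:
  assumes "is_gc_graph (\<Union>(set es)) es"
  shows "\<partial> (list_class es :: 'k::field_char_0 gc) = (\<Sum>i<length es.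
    gc_scale ((-1) ^ (i + length es)) (list_class (contract_edges i es)))"
proof -
  obtain G where G: "edges G = es" using assms by (rule gc_graph_exists)
  have "list_class (contract_edges i es) = (gc_class (contract i G) :: 'k gc)"
    if "i < length es" "loop_free (contract_edges i es)" for i
    using that edges_contract[of i G] list_class_edges[of "contract i G"] by (simp add: G)
  then have "(if loop_free (contract_edges i es) \<and> distinct (contract_edges i es)
        then gc_scale ((-1) ^ (i + length es)) (gc_class (contract i G)) else 0 :: 'k gc) =
      gc_scale ((-1) ^ (i + length es)) (list_class (contract_edges i es))"
    if "i < length es" for i
    using that by (simp add: list_class_eq_0)
  then show ?thesis
    unfolding list_class_edges[of G, unfolded G] gc_boundary_class[of G, unfolded G]
    by (intro sum.cong refl) simp
qed

section \<open>Relabelling of vertices and reordering of edges\<close>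

lemma is_gc_graph_image:
  assumes G: "is_gc_graph V es" and inj: "inj_on f V"
  shows "is_gc_graph (f ` V) (map ((`) f) es)"
proof -
  have sub: "e \<subseteq> V" if "e \<in> set es" for e using G that by (auto simp: is_gc_graph_def)
  have "card (f ` e) = card e" if "e \<in> set es" for e
    using inj sub[OF that] by (meson card_image inj_on_subset)
  then have lf: "loop_free (map ((`) f) es)"
    using G by (auto simp: is_gc_graph_def loop_free_def)
  have val: "valence (map ((`) f) es) (f v) = valence es v" if "v \<in> V" for v
  proof -
    have "f v \<in> f ` e \<longleftrightarrow> v \<in> e" if "e \<in> set es" for e
      using inj sub[OF that] \<open>v \<in> V\<close> by (simp add: inj_on_image_mem_iff)
    then have "filter ((\<lambda>e. f v \<in> e) \<circ> (`) f) es = filter (\<lambda>e. v \<in> e) es"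
      by (intro filter_cong) auto
    then show ?thesis by (simp add: valence_def filter_map)
  qed
  have "(f u, f v) \<in> {(x, y). {x, y} \<in> set (map ((`) f) es)}\<^sup>*"
    if "(u, v) \<in> {(x, y). {x, y} \<in> set es}\<^sup>*" for u v
    using that
  proof (induction rule: rtrancl_induct)
    case (step y z)
    then have "{f y, f z} \<in> set (map ((`) f) es)"
      by (auto intro!: image_eqI[of _ _ "{y, z}"])
    then show ?case using step.IH by (auto intro: rtrancl_into_rtrancl)
  qed simp
  moreover have "\<forall>e\<in>set (map ((`) f) es). e \<subseteq> f ` V" using sub by (simp add: image_mono)
  ultimately show ?thesis using G lf val by (simp add: is_gc_graph_def)
qed

text \<open>Edges keep their positions, so the permutation of labels is the identity and no sign
  arises.\<close>

lemma list_class_relabel: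
  assumes inj: "inj_on f (\<Union>(set es))"
  shows "list_class (map ((`) f) es) = (list_class es :: 'k::field_char_0 gc)"
proof -
  let ?V = "\<Union>(set es)"
  have V: "\<Union>(set (map ((`) f) es)) = f ` ?V" by auto
  show ?thesis
  proof (cases "is_gc_graph ?V es")
    case True
    then have img: "is_gc_graph (f ` ?V) (map ((`) f) es)" using inj by (rule is_gc_graph_image)
    obtain G where G: "verts G = ?V" "edges G = es" using True by (rule gc_graph_exists)
    obtain H where H: "verts H = f ` ?V" "edges H = map ((`) f) es"
      using img by (rule gc_graph_exists)
    have "gc_iso f id G H"
      using inj by (simp add: gc_iso_def G H bij_betw_def permutes_id)
    then show ?thesis
      using gc_class_iso[of f id G H] unfolding list_class_edges[of G, unfolded G]
        list_class_edges[of H, unfolded H] by (metis gc.scale_one of_int_1 sign_id)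
  next
    case False
    \<comment> \<open>Both sides must take the default value together; relabelling back by the
      inverse of \<open>f\<close> shows this.\<close>
    let ?g = "inv_into ?V f"
    have "?g ` f ` e = e" if "e \<in> set es" for e
      using inj that by (intro inv_into_image_cancel) auto
    then have "map ((`) ?g) (map ((`) f) es) = es" by (simp add: map_idI)
    moreover have "?g ` f ` ?V = ?V" by (rule inv_into_image_cancel[OF inj]) simp
    moreover have "inj_on ?g (f ` ?V)" by (rule inj_on_inv_into) simp
    ultimately have "\<not> is_gc_graph (f ` ?V) (map ((`) f) es)"
      using False is_gc_graph_image[of "f ` ?V" "map ((`) f) es" ?g] by auto
    then show ?thesis using False by (simp only: list_class_def V if_False)
  qed
qed

lemma list_class_swap:
  "list_class (xs @ a # b # ys) = - (list_class (xs @ b # a # ys) :: 'k::field_char_0 gc)"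
proof -
  let ?l = "xs @ a # b # ys" and ?l' = "xs @ b # a # ys"
  have set: "set ?l = set ?l'" by auto
  have gc: "is_gc_graph V ?l \<longleftrightarrow> is_gc_graph V ?l'" for V
    by (simp add: is_gc_graph_def loop_free_def valence_def set insert_commute) auto
  show ?thesis
  proof (cases "is_gc_graph (\<Union>(set ?l)) ?l")
    case True
    then have "is_gc_graph (\<Union>(set ?l)) ?l'" using gc by simp
    then obtain H where H: "verts H = \<Union>(set ?l)" "edges H = ?l'" by (rule gc_graph_exists)
    obtain G where G: "verts G = \<Union>(set ?l)" "edges G = ?l" using True by (rule gc_graph_exists)
    let ?i = "length xs"
    have "?l' ! transpose ?i (Suc ?i) i = ?l ! i" if "i < length ?l" for i
      using that by (auto simp: transpose_def nth_append nth_Cons split: nat.split)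
    then have "gc_iso id (transpose ?i (Suc ?i)) G H"
      unfolding gc_iso_def G H by (auto intro!: permutes_swap_id)
    then show ?thesis
      unfolding list_class_edges[of G, unfolded G, symmetric]
        list_class_edges[of H, unfolded H, symmetric]
      using gc_class_iso[of id "transpose ?i (Suc ?i)" G H, where ?'a = 'k]
        list_class_edges[of G, where ?'a = 'k] list_class_edges[of H, where ?'a = 'k]
      by (simp add: G H sign_swap_id)
  next
    case False
    moreover have "\<not> is_gc_graph (\<Union>(set ?l')) ?l'" using False unfolding set by (metis gc)
    ultimately show ?thesis by (simp only: list_class_def if_False minus_zero)
  qed
qed

lemma list_class_move:
  "(list_class (xs @ ys @ a # zs) :: 'k::field_char_0 gc) =
     gc_scale ((-1) ^ length ys) (list_class (xs @ a # ys @ zs))"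
proof (induction ys arbitrary: xs)
  case (Cons b ys)
  have "(list_class (xs @ (b # ys) @ a # zs) :: 'k gc) =
      gc_scale ((-1) ^ length ys) (list_class (xs @ b # a # ys @ zs))"
    using Cons.IH[of "xs @ [b]"] by simp
  also have "list_class (xs @ b # a # ys @ zs) = - (list_class (xs @ a # b # ys @ zs) :: 'k gc)"
    by (rule list_class_swap)
  finally show ?case by (simp add: gc.scale_minus_right)
qed simp

text \<open>Three edges move past \<open>ys\<close> by \<open>3 * length ys\<close> swaps, a number
  with the parity of \<open>length ys\<close>.\<close>

lemma list_class_move_triple:
  "(list_class (xs @ ys @ [a, b, c] @ zs) :: 'k::field_char_0 gc) =
     gc_scale ((-1) ^ length ys) (list_class (xs @ [a, b, c] @ ys @ zs))"
proof -
  have s: "(- 1 :: 'k) ^ length ys * (- 1) ^ length ys = 1"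
    by (simp flip: power_mult_distrib)
  show ?thesis
    using list_class_move[of xs ys a "b # c # zs", where ?'k = 'k]
      list_class_move[of "xs @ [a]" ys b "c # zs", where ?'k = 'k]
      list_class_move[of "xs @ [a, b]" ys c zs, where ?'k = 'k]
    by (simp add: s flip: mult.assoc)
qed

text \<open>This frees the argument from the order in which the edges of a given wheel are
  listed.\<close>

lemma list_class_mset:
  assumes "mset es = mset es'"
  shows "list_class es = (list_class es' :: 'k::field_char_0 gc) \<or> list_class es = - (list_class es' :: 'k gc)"
proof -
  have "list_class (xs @ es) = (list_class (xs @ es') :: 'k gc) \<or>
      list_class (xs @ es) = - (list_class (xs @ es') :: 'k gc)" for xs
    using assms
  proof (induction es arbitrary: xs es')
    case (Cons a es)
    then have "a \<in> set es'" by (metis list.set_intros(1) set_mset_mset)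
    then obtain p q where es': "es' = p @ a # q" by (metis split_list)
    then have "mset es = mset (p @ q)" using Cons.prems by simp
    then have "list_class ((xs @ [a]) @ es) = (list_class ((xs @ [a]) @ p @ q) :: 'k gc) \<or>
        list_class ((xs @ [a]) @ es) = - (list_class ((xs @ [a]) @ p @ q) :: 'k gc)"
      by (rule Cons.IH)
    then show ?case
      using list_class_move[of xs p a q, where ?'k = 'k] by (cases "even (length p)") (auto simp: es')
  qed simp
  from this[of "[]"] show ?thesis by simp
qed

section \<open>The boundary squares to zero\<close>

text \<open>The first merge turns \<open>f\<close> into \<open>Min e\<close> together with
  \<open>f - e\<close>, whose minimum is that of the union. The result is symmetric in the two
  edges, as commutation requires.\<close>

lemma merge_merge_overlap:
  assumes "finite e" "finite f" "e \<inter> f \<noteq> {}"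
  shows "merge (merge e ` f) (merge e x) = merge (e \<union> f) x"
proof -
  have ne: "e \<noteq> {}" using assms by auto
  have img: "merge e ` f = insert (Min e) (f - e)"
    using assms(3) by (auto simp: merge_def image_iff)
  have "Min (merge e ` f) = Min (e \<union> f)"
  proof (rule Min_eqI[symmetric])
    show "Min (merge e ` f) \<le> y" if "y \<in> e \<union> f" for y
    proof -
      have "merge e y \<in> merge e ` f" "merge e y \<le> y"
        using that assms ne by (auto simp: img merge_def)
      then show ?thesis using assms(2) by (meson Min_le finite_imageI le_trans)
    qed
    have "Min (merge e ` f) \<in> merge e ` f" using assms by (intro Min_in) auto
    then show "Min (merge e ` f) \<in> e \<union> f" using Min_in[OF assms(1) ne] unfolding img by (metis DiffD1 UnI1 UnI2 insertE)
  qed (use assms in simp)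
  moreover have "merge e x \<in> merge e ` f \<longleftrightarrow> x \<in> e \<union> f"
  proof (cases "x \<in> e")
    case False
    then have "x \<noteq> Min e" using assms(1) ne Min_in by blast
    then show ?thesis using False unfolding img by (simp add: merge_def)
  next
    case True
    then show ?thesis unfolding img by (simp add: merge_def)
  qed
  ultimately show ?thesis
    unfolding merge_def[of "merge e ` f"] by (simp add: merge_def)
qed

text \<open>Disjoint edges leave each other alone; overlapping ones give the merge of
  \<open>e \<union> f\<close> in either order.\<close>

lemma merge_merge_commute:
  assumes "finite e" "finite f" "e \<noteq> {}" "f \<noteq> {}"
  shows "merge (merge e ` f) (merge e x) = merge (merge f ` e) (merge f x)"
proof (cases "e \<inter> f = {}")
  case True
  then have "merge e ` f = f" "merge f ` e = e" by (auto simp: merge_def image_iff)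
  moreover have "Min e \<in> e" "Min f \<in> f" using assms by auto
  ultimately show ?thesis using True by (auto simp: merge_def)
next
  case False
  then show ?thesis
    using merge_merge_overlap[of e f x] merge_merge_overlap[of f e x] assms
    by (simp add: Un_commute Int_commute)
qed

text \<open>Once the edge at \<open>i\<close> is gone, the edge formerly at \<open>Suc j\<close>
  sits at \<open>j\<close>; this shift makes the square of the boundary cancel.\<close>

lemma contract_edges_commute:
  assumes fin: "\<And>e. e \<in> set es \<Longrightarrow> finite e \<and> e \<noteq> {}" and ij: "i \<le> j" "j < length es - 1"
  shows "contract_edges j (contract_edges i es) = contract_edges i (contract_edges (Suc j) es)"
proof (rule nth_equalityI)
  show "length (contract_edges j (contract_edges i es)) =
      length (contract_edges i (contract_edges (Suc j) es))"
    using ij by (simp add: length_contract_edges)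
next
  fix l assume "l < length (contract_edges j (contract_edges i es))"
  then have l: "l < length es - 1 - 1" using ij by (simp add: length_contract_edges)
  \<comment> \<open>\<open>q\<close> is the position in \<open>es\<close> of the edge that ends up
    at \<open>l\<close> after both contractions.\<close>
  define q where "q = (if l < i then l else if l < j then Suc l else Suc (Suc l))"
  have m: "merge (merge (es ! i) ` (es ! Suc j)) ` merge (es ! i) ` A =
      merge (merge (es ! Suc j) ` (es ! i)) ` merge (es ! Suc j) ` A" for A
    unfolding image_image using fin ij by (intro image_cong refl merge_merge_commute) auto
  have "contract_edges j (contract_edges i es) ! l =
      merge (merge (es ! i) ` (es ! Suc j)) ` merge (es ! i) ` (es ! q)"
    using ij l by (simp add: nth_contract_edges length_contract_edges q_def)
  moreover have "contract_edges i (contract_edges (Suc j) es) ! l =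
      merge (merge (es ! Suc j) ` (es ! i)) ` merge (es ! Suc j) ` (es ! q)"
    using ij l by (simp add: nth_contract_edges length_contract_edges q_def)
  ultimately show "contract_edges j (contract_edges i es) ! l =
      contract_edges i (contract_edges (Suc j) es) ! l"
    using m by simp
qed

text \<open>An edge collapses only if both its ends lie in the contracted edge, so only a parallel
  edge can become a loop.\<close>

lemma loop_free_contract_edges:
  assumes "loop_free es" "distinct es" "i < length es"
  shows "loop_free (contract_edges i es)"
  unfolding loop_free_def
proof
  fix e' assume "e' \<in> set (contract_edges i es)"
  then obtain l where l: "l < length es - 1" "e' = contract_edges i es ! l"
    using assms(3) by (auto simp: in_set_conv_nth length_contract_edges)
  define q where "q = (if l < i then l else Suc l)"
  have q: "q < length es" "q \<noteq> i" using l by (auto simp: q_def)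
  have e': "e' = merge (es ! i) ` (es ! q)"
    using l assms(3) by (simp add: nth_contract_edges q_def)
  have c: "card (es ! i) = 2" "card (es ! q) = 2"
    using assms q by (auto simp: loop_free_def)
  have ne: "es ! q \<noteq> es ! i" using q assms by (simp add: nth_eq_iff_index_eq)
  have fin: "finite (es ! i)" "es ! i \<noteq> {}" using c(1) by (auto simp: card_ge_0_finite)
  then have Min: "Min (es ! i) \<in> es ! i" by simp
  have "inj_on (merge (es ! i)) (es ! q)"
  proof (rule inj_onI)
    fix x y assume xy: "x \<in> es ! q" "y \<in> es ! q" "merge (es ! i) x = merge (es ! i) y"
    show "x = y"
    proof (rule ccontr)
      assume "x \<noteq> y"
      then have "x \<in> es ! i" "y \<in> es ! i"
        using xy(3) Min by (auto simp: merge_def split: if_splits)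
      moreover have "es ! q = {x, y}" using xy \<open>x \<noteq> y\<close> c(2) by (auto simp: card_2_iff)
      ultimately show False
        using c fin ne by (metis card_subset_eq empty_subsetI insert_subset)
    qed
  qed
  then show "card e' = 2" using c(2) by (simp add: e' card_image)
qed

text \<open>Each pair of edges is contracted in both orders, with opposite signs.\<close>

lemma gc_boundary_boundary_list_class: "\<partial> (\<partial> (list_class es)) = (0 :: 'k::field_char_0 gc)"
proof -
  interpret b: Vector_Spaces.linear gc_scale gc_scale "\<partial> :: 'k gc \<Rightarrow> 'k gc"
    by (rule gc_boundary_linear)
  show ?thesis
  proof (cases "is_gc_graph (\<Union>(set es)) es \<and> distinct es")
    case False
    then have "list_class es = (0 :: 'k gc)"
      using list_class_eq_0[of es] by (auto simp: list_class_def)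
    then show ?thesis by (simp add: b.zero)
  next
    case True
    let ?E = "length es"
    define F :: "nat \<Rightarrow> nat \<Rightarrow> 'k gc" where
      "F i j = list_class (contract_edges j (contract_edges i es))" for i j
    define g where "g = (\<lambda>(i, j). gc_scale ((-1) ^ (i + j + 1)) (F i j))"
    have lf: "loop_free es" using True by (auto simp: is_gc_graph_def)
    then have "\<And>e. e \<in> set es \<Longrightarrow> card e = 2" by (simp add: loop_free_def)
    then have fin: "finite e \<and> e \<noteq> {}" if "e \<in> set es" for e
      using that by (metis card.empty card.infinite zero_neq_numeral)
    have d: "\<partial> (list_class (contract_edges i es)) = (\<Sum>j<?E - 1.
        gc_scale ((-1) ^ (j + (?E - 1))) (F i j))" if i: "i < ?E" for i
    proof -
      have "is_gc_graph (merge (es ! i) ` \<Union>(set es)) (contract_edges i es)"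
        using True lf i by (intro is_gc_graph_contract loop_free_contract_edges) auto
      then have "is_gc_graph (\<Union>(set (contract_edges i es))) (contract_edges i es)"
        using is_gc_graph_verts by metis
      from gc_boundary_list_class[OF this] show ?thesis
        using i by (simp add: F_def length_contract_edges)
    qed
    have "\<partial> (\<partial> (list_class es)) =
        (\<Sum>i<?E. gc_scale ((-1) ^ (i + ?E)) (\<partial> (list_class (contract_edges i es))) :: 'k gc)"
      using gc_boundary_list_class[of es, where ?'k = 'k] True by (simp add: b.sum b.scale)
    also have "\<dots> = (\<Sum>i<?E. \<Sum>j<?E - 1. g (i, j))"
    proof (intro sum.cong refl)
      fix i assume "i \<in> {..<?E}"
      then have i: "i < ?E" by simp
      have sg: "(-1 :: 'k) ^ (i + ?E) * (-1) ^ (j + (?E - 1)) = (-1) ^ (i + j + 1)" for j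
        using i by (cases es) (auto simp: minus_one_power_iff)
      show "gc_scale ((-1) ^ (i + ?E)) (\<partial> (list_class (contract_edges i es))) =
          (\<Sum>j<?E - 1. g (i, j))"
        unfolding d[OF i] gc.scale_sum_right gc.scale_scale sg g_def prod.case ..
    qed
    also have "\<dots> = sum g ({..<?E} \<times> {..<?E - 1})" by (simp add: sum.cartesian_product)
    \<comment> \<open>The pair \<open>(i, j)\<close> with \<open>i \<le> j\<close> is matched with
      \<open>(Suc j, i)\<close>, which raises the index sum by one and so flips the sign.\<close>
    also have "{..<?E} \<times> {..<?E - 1} =
        {(i, j). i \<le> j \<and> j < ?E - 1} \<union> {(i, j). j < i \<and> i < ?E}" (is "_ = ?A \<union> ?B") by auto
    also have "sum g \<dots> = sum g ?A + sum g ?B"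
      by (intro sum.union_disjoint)
        (auto intro: finite_subset[of _ "{..<?E} \<times> {..<?E}"])
    also have "sum g ?B = (\<Sum>(i, j)\<in>?A. g (Suc j, i))"
      by (rule sum.reindex_bij_witness[of _ "\<lambda>(i, j). (Suc j, i)" "\<lambda>(i, j). (j, i - 1)"]) auto
    also have "\<dots> = (\<Sum>x\<in>?A. - g x)"
      using contract_edges_commute[of es, OF fin]
      by (intro sum.cong refl) (auto simp: g_def F_def add.commute)
    finally show ?thesis by (simp add: sum_negf)
  qed
qed

lemma gc_boundary_boundary: "\<partial> (\<partial> x) = (0 :: 'k::field_char_0 gc)"
proof -
  interpret b: Vector_Spaces.linear gc_scale gc_scale "\<partial> :: 'k gc \<Rightarrow> 'k gc"
    by (rule gc_boundary_linear)
  have "x \<in> gc.span (range gc_class)" by (simp add: gc_span_classes)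
  then show ?thesis
  proof (induction rule: gc.span_induct_alt)
    case base
    show ?case by (simp add: b.zero)
  next
    case (step c y z)
    then obtain G where "y = list_class (edges G)" by (auto simp: list_class_edges)
    then show ?case using step.IH by (simp add: b.add b.scale gc_boundary_boundary_list_class)
  qed
qed

lemma contract_edges_nth:
  "i = length xs \<Longrightarrow> contract_edges i (xs @ e # ys) = map ((`) (merge e)) (xs @ ys)"
  by (simp add: contract_edges_def)

text \<open>Contracting a side of a triangle turns the other two sides into a double edge.\<close>

lemma list_class_contract_triangle:
  assumes i: "i < length es" "es ! i = {u, v}" and e: "{u, z} \<in> set es" "{v, z} \<in> set es"
    and ne: "u \<noteq> v" "z \<noteq> u" "z \<noteq> v"
  shows "list_class (contract_edges i es) = 0"
proof -
  let ?l = "take i es @ drop (Suc i) es" and ?h = "(`) (merge {u, v})"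
  have "set es = insert {u, v} (set ?l)"
    using i by (metis id_take_nth_drop list.simps(15) set_append Un_insert_right)
  then have "{u, z} \<in> set ?l" "{v, z} \<in> set ?l"
    using e ne by (auto simp: doubleton_eq_iff)
  moreover have "?h {u, z} = ?h {v, z}" using ne by (simp add: merge_def)
  moreover have "{u, z} \<noteq> {v, z}" using ne by (auto simp: doubleton_eq_iff)
  ultimately have "\<not> inj_on ?h (set ?l)" by (meson inj_onD)
  then have "\<not> distinct (map ?h ?l)" using distinct_map by blast
  then show ?thesis using i by (intro list_class_eq_0) (simp add: contract_edges_def)
qed

lemma map_image_fix: "(\<And>z. z \<in> \<Union>(set xs) \<Longrightarrow> f z = z) \<Longrightarrow> map ((`) f) xs = xs"
  by (intro map_idI) (force simp: image_iff)

section \<open>Wheels with the hub blown up to a path\<close>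

text \<open>Rim edges stand at even positions and spokes from \<open>c\<close> at odd ones. The ends
  \<open>u\<close> and \<open>v\<close> get no spoke, so the first and last edges lie in no triangle
  of the fan.\<close>

fun fan :: "nat \<Rightarrow> nat \<Rightarrow> nat \<Rightarrow> nat list \<Rightarrow> nat set list" where
  "fan c u v [] = [{u, v}]"
| "fan c u v (y # ys) = {u, y} # {c, y} # fan c y v ys"

lemma length_fan [simp]: "length (fan c u v ys) = 2 * length ys + 1"
  by (induction ys arbitrary: u) auto

lemma map_fan: "map ((`) f) (fan c u v ys) = fan (f c) (f u) (f v) (map f ys)"
  by (induction ys arbitrary: u) auto

lemma fan_snoc: "fan c u v (ys @ [y]) = fan c u y ys @ [{c, y}, {y, v}]"
  by (induction ys arbitrary: u) auto

lemma fan_verts: "\<Union>(set (fan c u v ys)) \<subseteq> insert c (insert u (insert v (set ys)))"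
  by (induction ys arbitrary: u) auto

lemma fan_nth_spoke: "j < length ys \<Longrightarrow> fan c u v ys ! (2 * j + 1) = {c, ys ! j}"
  by (induction ys arbitrary: u j) (auto simp: nth_Cons split: nat.split)

lemma fan_nth_rim: "Suc j < length ys \<Longrightarrow> fan c u v ys ! (2 * j + 2) = {ys ! j, ys ! Suc j}"
proof (induction ys arbitrary: u j)
  case (Cons y ys)
  show ?case
  proof (cases j)
    case 0
    then show ?thesis using Cons.prems by (cases ys) auto
  next
    case (Suc j')
    then show ?thesis using Cons.IH[of j' y] Cons.prems by simp
  qed
qed simp

lemma valence_simps [simp]:
  "valence [] z = 0"
  "valence (e # es) z = (if z \<in> e then 1 else 0) + valence es z"
  "valence (es @ es') z = valence es z + valence es' z"
  by (auto simp: valence_def)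

lemma valence_fan:
  assumes "distinct (c # u # v # ys)"
  shows "valence (fan c u v ys) z =
    (if z = c then length ys else if z \<in> set ys then 3 else if z = u \<or> z = v then 1 else 0)"
  using assms by (induction ys arbitrary: u) auto

text \<open>
  The continuation \<open>B\<close> describes what is glued to the strip.
  The ports \<open>p True\<close> and \<open>p False\<close> are the ends of the rim built so far, \<open>a\<close> is the last vertex of
  the path that replaces the hub, and the vertices from \<open>k\<close> on are unused. The letter \<open>x\<close> prolongs
  the path by the vertex \<open>k\<close>, and the rim on the side \<open>x\<close> by the vertex \<open>k + 1\<close>.
\<close>

fun strip :: "bool list \<Rightarrow> (bool \<Rightarrow> nat) \<Rightarrow> nat \<Rightarrow> nat \<Rightarrow>
    ((bool \<Rightarrow> nat) \<Rightarrow> nat \<Rightarrow> nat \<Rightarrow> nat set list) \<Rightarrow> nat set list" where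
  "strip [] p a k B = B p a k"
| "strip (x # w) p a k B =
     [{a, k}, {k, p x}, {k, k + 1}, {p x, k + 1}] @ strip w (p(x := k + 1)) k (k + 2) B"

text \<open>The vertex \<open>k\<close> is the cap. Its path edge comes first, then the fan from
  port \<open>True\<close> to port \<open>False\<close>, so the outer rim edges come second and
  last.\<close>

definition cap :: "nat \<Rightarrow> (bool \<Rightarrow> nat) \<Rightarrow> nat \<Rightarrow> nat \<Rightarrow> nat set list" where
  "cap n p a k = {a, k} # fan k (p True) (p False) [k + 1..<k + 1 + n]"

text \<open>The starting triangle has the path vertex \<open>0\<close> and the adjacent rim vertices
  \<open>1\<close> and \<open>2\<close>, which become the first ports.\<close>

definition closed_strip ::
    "bool list \<Rightarrow> ((bool \<Rightarrow> nat) \<Rightarrow> nat \<Rightarrow> nat \<Rightarrow> nat set list) \<Rightarrow> nat set list" where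
  "closed_strip w B =
     [{0, 1}, {0, 2}, {1, 2}] @ strip w (\<lambda>x. if x then 1 else 2) 0 3 B"

text \<open>Invariant preserved by each letter; it keeps \<open>k\<close> and all later numbers
  distinct from the ports and the path end.\<close>

definition ports_ok :: "(bool \<Rightarrow> nat) \<Rightarrow> nat \<Rightarrow> nat \<Rightarrow> bool" where
  "ports_ok p a k \<longleftrightarrow> (\<forall>x. p x < k \<and> p x \<noteq> a) \<and> p True \<noteq> p False \<and> a < k"

lemma ports_ok_start: "ports_ok (\<lambda>x. if x then 1 else 2) 0 3"
  by (simp add: ports_ok_def)

lemma ports_ok_step: "ports_ok p a k \<Longrightarrow> ports_ok (p(x := k + 1)) k (k + 2)"
  by (cases x) (auto simp: ports_ok_def all_bool_eq)

lemma strip_append: "strip (u @ v) p a k B = strip u p a k (\<lambda>p a k. strip v p a k B)"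
  by (induction u arbitrary: p a k) auto

text \<open>The state in which a strip calls its continuation depends only on the word and the
  initial state, so one prefix \<open>ps\<close> serves every \<open>B\<close> and different ends of
  a word can be compared. Each letter adds four edges and two vertices.\<close>

lemma strip_decomp:
  assumes "ports_ok p a k"
  obtains ps p' a' where "length ps = 4 * length w"
    and "\<And>B. strip w p a k B = ps @ B p' a' (k + 2 * length w)"
    and "\<Union>(set ps) \<subseteq> {..<k + 2 * length w}" and "ports_ok p' a' (k + 2 * length w)"
proof -
  have "\<exists>ps p' a'. length ps = 4 * length w \<and>
      (\<forall>B. strip w p a k B = ps @ B p' a' (k + 2 * length w)) \<and>
      \<Union>(set ps) \<subseteq> {..<k + 2 * length w} \<and> ports_ok p' a' (k + 2 * length w)"
    using assms
  proof (induction w arbitrary: p a k)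
    case Nil
    then show ?case by (intro exI[of _ "[]"] exI[of _ p] exI[of _ a]) simp
  next
    case (Cons x w)
    obtain ps p' a' where *: "length ps = 4 * length w"
      "\<And>B. strip w (p(x := k + 1)) k (k + 2) B = ps @ B p' a' (k + 2 + 2 * length w)"
      "\<Union>(set ps) \<subseteq> {..<k + 2 + 2 * length w}" "ports_ok p' a' (k + 2 + 2 * length w)"
      using Cons.IH[OF ports_ok_step[OF Cons.prems, of x]] by blast
    have "p x < k" "a < k" using Cons.prems by (auto simp: ports_ok_def)
    then show ?case
      using * by (intro exI[of _ "[{a, k}, {k, p x}, {k, k + 1}, {p x, k + 1}] @ ps"]
          exI[of _ p'] exI[of _ a']) (auto simp: add_ac)
  qed
  then show ?thesis using that by blast
qed

lemma closed_strip_decomp: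
  obtains ps p a where "length ps = 3 + 4 * length w"
    and "\<And>v B. closed_strip (w @ v) B = ps @ strip v p a (3 + 2 * length w) B"
    and "\<Union>(set ps) \<subseteq> {..<3 + 2 * length w}" and "ports_ok p a (3 + 2 * length w)"
proof -
  obtain ps p a where "length ps = 4 * length w"
    and "\<And>B. strip w (\<lambda>x. if x then 1 else 2) 0 3 B = ps @ B p a (3 + 2 * length w)"
    and "\<Union>(set ps) \<subseteq> {..<3 + 2 * length w}" and "ports_ok p a (3 + 2 * length w)"
    using strip_decomp[OF ports_ok_start] by metis
  then show ?thesis
    by (intro that[of "[{0, 1}, {0, 2}, {1, 2}] @ ps" p a])
      (auto simp: closed_strip_def strip_append)
qed

lemma length_closed_strip_cap: "length (closed_strip w (cap n)) = 4 * length w + 2 * n + 5"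
proof -
  obtain ps p a where "length ps = 3 + 4 * length w"
    and "\<And>v B. closed_strip (w @ v) B = ps @ strip v p a (3 + 2 * length w) B"
    using closed_strip_decomp[of w] by metis
  from this(1) this(2)[of "[]" "cap n"] show ?thesis by (simp add: cap_def)
qed

text \<open>The vertices introduced by a strip are at least \<open>k\<close>, hence fixed by
  \<open>f\<close>; only the initial ports and path end can move.\<close>

lemma strip_relabel:
  assumes "\<And>z. k \<le> z \<Longrightarrow> f z = z"
  shows "map ((`) f) (strip w p a k (cap n)) = strip w (f \<circ> p) (f a) k (cap n)"
  using assms
proof (induction w arbitrary: p a k)
  case Nil
  then have "map f [k + 1..<k + 1 + n] = [k + 1..<k + 1 + n]" by (intro map_idI) auto
  then show ?case using Nil by (simp add: cap_def map_fan)
next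
  case (Cons x w)
  have p: "f \<circ> p(x := k + 1) = (f \<circ> p)(x := k + 1)" using Cons.prems by (auto simp: fun_eq_iff)
  have "f k = k" "f (k + 1) = k + 1" using Cons.prems by simp_all
  moreover have "map ((`) f) (strip w (p(x := k + 1)) k (k + 2) (cap n)) =
      strip w ((f \<circ> p)(x := k + 1)) (f k) (k + 2) (cap n)"
    unfolding p[symmetric] by (rule Cons.IH) (use Cons.prems in simp)
  ultimately show ?case by (simp add: comp_def)
qed

section \<open>Blown-up wheels are graphs of the complex\<close>

text \<open>The bound \<open>1\<close> for ports and path end drives the induction: a new rim vertex
  gets two edges from its own letter and at least one from the rest. The cap has valence
  \<open>n + 1\<close>, whence \<open>2 \<le> n\<close>.\<close>

lemma strip_valence_ge:
  assumes "ports_ok p a k" "2 \<le> n"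
  shows "(\<forall>x. 1 \<le> valence (strip w p a k (cap n)) (p x)) \<and>
    1 \<le> valence (strip w p a k (cap n)) a \<and>
    (\<forall>z\<in>\<Union>(set (strip w p a k (cap n))). k \<le> z \<longrightarrow> 3 \<le> valence (strip w p a k (cap n)) z)"
  using assms(1)
proof (induction w arbitrary: p a k)
  case Nil
  define ys where "ys = [k + 1..<k + 1 + n]"
  have cap: "cap n p a k = {a, k} # fan k (p True) (p False) ys"
    by (simp add: cap_def ys_def del: upt_Suc)
  have ys: "length ys = n" "set ys = {k + 1..<k + 1 + n}"
    by (simp_all add: ys_def del: upt_Suc)
  have ok: "p True < k" "p False < k" "p True \<noteq> p False" "a < k"
    using Nil by (auto simp: ports_ok_def)
  moreover have "distinct ys" by (simp add: ys_def)
  ultimately have "distinct (k # p True # p False # ys)" by (auto simp: ys)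
  note V = valence_fan[OF this]
  have "1 \<le> valence (cap n p a k) (p x)" for x
    using ok by (cases x) (auto simp: cap V ys)
  moreover have "1 \<le> valence (cap n p a k) a" by (simp add: cap)
  moreover have "3 \<le> valence (cap n p a k) z" if "z \<in> \<Union>(set (cap n p a k))" "k \<le> z" for z
  proof -
    have "z = k \<or> z \<in> set ys"
      using that ok fan_verts[of k "p True" "p False" ys] unfolding cap by auto
    then show ?thesis using assms(2) ys(1) by (auto simp: cap V)
  qed
  ultimately show ?case by simp
next
  case (Cons x w)
  define q where "q = p(x := k + 1)"
  define T where "T = strip w q k (k + 2) (cap n)"
  have S: "strip (x # w) p a k (cap n) = [{a, k}, {k, p x}, {k, k + 1}, {p x, k + 1}] @ T"
    by (simp add: T_def q_def)
  have "ports_ok q k (k + 2)" unfolding q_def by (rule ports_ok_step[OF Cons.prems])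
  note IH = Cons.IH[OF this, folded T_def]
  have T: "1 \<le> valence T (k + 1)" "1 \<le> valence T (p (\<not> x))" "1 \<le> valence T k"
    using IH[THEN conjunct1, rule_format, of x] IH[THEN conjunct1, rule_format, of "\<not> x"] IH
    by (simp_all add: q_def)
  have lt: "p x < k" "a < k" using Cons.prems by (auto simp: ports_ok_def)
  have "1 \<le> valence (strip (x # w) p a k (cap n)) (p y)" for y
  proof -
    have "y = x \<or> y = (\<not> x)" by auto
    then show ?thesis using T(2) unfolding S by auto
  qed
  moreover have "3 \<le> valence (strip (x # w) p a k (cap n)) z"
    if "z \<in> \<Union>(set (strip (x # w) p a k (cap n)))" "k \<le> z" for z
  proof -
    have "z = k \<or> z = k + 1 \<or> k + 2 \<le> z" using that by linarith
    then consider "z = k" | "z = k + 1" | "k + 2 \<le> z" by blast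
    then show ?thesis
    proof cases
      case 3
      then have "z \<in> \<Union>(set T)" using that lt unfolding S by auto
      then have "3 \<le> valence T z" using IH 3 by blast
      then show ?thesis unfolding S by simp
    qed (use T(1,3) lt in \<open>auto simp: S simp del: strip.simps\<close>)
  qed
  ultimately show ?case unfolding S by simp
qed

lemma rtrancl_edge: "{u, v} \<in> set es \<Longrightarrow> (u, v) \<in> {(x, y). {x, y} \<in> set es}\<^sup>*"
  by (rule r_into_rtrancl) simp

lemma rtrancl_edges_mono:
  assumes "(u, v) \<in> {(x, y). {x, y} \<in> set es}\<^sup>*" "set es \<subseteq> set es'"
  shows "(u, v) \<in> {(x, y). {x, y} \<in> set es'}\<^sup>*"
  using assms(1) by (rule rtrancl_mono[THEN subsetD, rotated]) (use assms(2) in auto)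

lemma strip_connected:
  assumes "z \<in> \<Union>(set (strip w p a k (cap n)))"
  shows "\<exists>s\<in>insert a (range p). (s, z) \<in> {(x, y). {x, y} \<in> set (strip w p a k (cap n))}\<^sup>*"
  using assms
proof (induction w arbitrary: p a k)
  case Nil
  define ys where "ys = [k + 1..<k + 1 + n]"
  have cap: "cap n p a k = {a, k} # fan k (p True) (p False) ys"
    by (simp add: cap_def ys_def del: upt_Suc)
  let ?R = "{(x, y). {x, y} \<in> set (cap n p a k)}\<^sup>*"
  have ak: "(a, k) \<in> ?R" by (rule rtrancl_edge) (simp add: cap)
  have "(a, y) \<in> ?R" if y: "y \<in> set ys" for y
  proof -
    obtain j where j: "j < length ys" "y = ys ! j" using y by (metis in_set_conv_nth)
    have "2 * j + 1 < length (fan k (p True) (p False) ys)" using j(1) by simp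
    from nth_mem[OF this] have "{k, y} \<in> set (fan k (p True) (p False) ys)"
      unfolding fan_nth_spoke[OF j(1)] j(2) .
    then have "(k, y) \<in> ?R" by (intro rtrancl_edge) (simp add: cap)
    with ak show ?thesis by (rule rtrancl_trans)
  qed
  moreover have "z = a \<or> z = k \<or> z = p True \<or> z = p False \<or> z \<in> set ys"
    using Nil fan_verts[of k "p True" "p False" ys] unfolding strip.simps cap by auto
  ultimately have "z \<in> insert a (range p) \<or> (a, z) \<in> ?R" using ak by auto
  then show ?case unfolding strip.simps by (metis insertI1 rtrancl.rtrancl_refl)
next
  case (Cons x w)
  define q where "q = p(x := k + 1)"
  define T where "T = strip w q k (k + 2) (cap n)"
  have S: "strip (x # w) p a k (cap n) = [{a, k}, {k, p x}, {k, k + 1}, {p x, k + 1}] @ T"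
    by (simp add: T_def q_def)
  let ?R = "{(x', y). {x', y} \<in> set (strip (x # w) p a k (cap n))}\<^sup>*"
  have ak: "(a, k) \<in> ?R" by (rule rtrancl_edge) (simp add: S del: strip.simps)
  have "(k, k + 1) \<in> ?R" by (rule rtrancl_edge) (simp add: S del: strip.simps)
  with ak have ak1: "(a, k + 1) \<in> ?R" by (rule rtrancl_trans)
  show ?case
  proof (cases "z \<in> \<Union>(set T)")
    case True
    from Cons.IH[OF this[unfolded T_def], folded T_def] obtain s
      where s: "s \<in> insert k (range q)" "(s, z) \<in> {(x, y). {x, y} \<in> set T}\<^sup>*" ..
    from s(2) have sz: "(s, z) \<in> ?R" by (rule rtrancl_edges_mono) (auto simp: S simp del: strip.simps)
    have "s = k \<or> s = k + 1 \<or> s \<in> range p"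
      using s(1) by (auto simp: q_def image_iff split: if_splits)
    then show ?thesis
    proof (elim disjE)
      assume "s = k"
      with sz have "(k, z) \<in> ?R" by simp
      with ak have "(a, z) \<in> ?R" by (rule rtrancl_trans)
      then show ?thesis by (intro bexI[of _ a]) simp_all
    next
      assume "s = k + 1"
      with sz have "(k + 1, z) \<in> ?R" by simp
      with ak1 have "(a, z) \<in> ?R" by (rule rtrancl_trans)
      then show ?thesis by (intro bexI[of _ a]) simp_all
    next
      assume "s \<in> range p"
      then show ?thesis using sz by (intro bexI[of _ s]) simp_all
    qed
  next
    case False
    then have "z = a \<or> z = k \<or> z = p x \<or> z = k + 1" using Cons.prems unfolding S by auto
    then have "z \<in> insert a (range p) \<or> (a, z) \<in> ?R" using ak ak1 by blast
    then show ?thesis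
    proof
      assume "z \<in> insert a (range p)"
      then show ?thesis by (intro bexI[of _ z]) simp_all
    next
      assume "(a, z) \<in> ?R"
      then show ?thesis by (intro bexI[of _ a]) simp_all
    qed
  qed
qed

lemma strip_edges:
  assumes "ports_ok p a k" "e \<in> set (strip w p a k (cap n))"
  shows "card e = 2"
  using assms
proof (induction w arbitrary: p a k)
  case Nil
  have "card e = 2" if "distinct (c # u # v # ys)" "e \<in> set (fan c u v ys)" for c u v ys
    using that by (induction ys arbitrary: u) (auto simp: card_insert_if)
  from this[of k "p True" "p False" "[k + 1..<k + 1 + n]"] show ?case
    using Nil by (auto simp: ports_ok_def all_bool_eq cap_def)
next
  case (Cons x w)
  define q where "q = p(x := k + 1)"
  have "p x < k" "a < k" using Cons.prems by (auto simp: ports_ok_def)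
  moreover have "ports_ok q k (k + 2)" unfolding q_def by (rule ports_ok_step[OF Cons.prems(1)])
  moreover have "e \<in> {{a, k}, {k, p x}, {k, k + 1}, {p x, k + 1}} \<union> set (strip w q k (k + 2) (cap n))"
    using Cons.prems(2) by (auto simp: q_def)
  ultimately show ?case using Cons.IH by auto
qed

lemma is_gc_graph_closed_strip_cap:
  assumes n: "2 \<le> n"
  shows "is_gc_graph (\<Union>(set (closed_strip w (cap n)))) (closed_strip w (cap n))"
proof -
  let ?p = "\<lambda>x. if x then 1 else 2 :: nat"
  let ?T = "strip w ?p 0 3 (cap n)" and ?es = "closed_strip w (cap n)"
  let ?R = "{(x, y). {x, y} \<in> set ?es}\<^sup>*"
  have es: "?es = [{0, 1}, {0, 2}, {1, 2}] @ ?T" by (simp add: closed_strip_def)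
  have c2: "\<forall>e\<in>set ?es. card e = 2" using strip_edges[OF ports_ok_start] by (auto simp: es)
  then have "\<forall>e\<in>set ?es. finite e" by (metis card.infinite zero_neq_numeral)
  then have fin: "finite (\<Union>(set ?es))" by blast
  have val: "3 \<le> valence ?es z" if z: "z \<in> \<Union>(set ?es)" for z
  proof -
    note T = strip_valence_ge[OF ports_ok_start n, of w]
    have T': "1 \<le> valence ?T 1" "1 \<le> valence ?T 2" "1 \<le> valence ?T 0"
      using T by (auto simp: all_bool_eq)
    have "z = 0 \<or> z = 1 \<or> z = 2 \<or> 3 \<le> z" by linarith
    then consider "z = 0" | "z = 1" | "z = 2" | "3 \<le> z" by blast
    then show ?thesis
    proof cases
      case 4
      then have "z \<in> \<Union>(set ?T)" using z by (auto simp: es)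
      then show ?thesis using 4 T unfolding es by auto
    qed (use T' in \<open>auto simp: es\<close>)
  qed
  have sym: "(u, v) \<in> ?R \<Longrightarrow> (v, u) \<in> ?R" for u v
    by (rule symD[OF sym_rtrancl]) (auto simp: sym_def insert_commute)
  have base: "(0, s) \<in> ?R" if "s \<in> insert 0 (range ?p)" for s
  proof -
    have "s = 0 \<or> s = 1 \<or> s = 2" using that by auto
    moreover have "(0, 1) \<in> ?R" "(0, 2) \<in> ?R" by (rule rtrancl_edge, simp add: es)+
    ultimately show ?thesis by auto
  qed
  have z0: "(0, z) \<in> ?R" if z: "z \<in> \<Union>(set ?es)" for z
  proof (cases "z \<in> \<Union>(set ?T)")
    case True
    from strip_connected[OF this] obtain s
      where s: "s \<in> insert 0 (range ?p)" "(s, z) \<in> {(x, y). {x, y} \<in> set ?T}\<^sup>*" ..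
    from s(2) have "(s, z) \<in> ?R" by (rule rtrancl_edges_mono) (auto simp: es)
    with base[OF s(1)] show ?thesis by (rule rtrancl_trans)
  next
    case False
    then have "z \<in> insert 0 (range ?p)" using z by (auto simp: es)
    then show ?thesis by (rule base)
  qed
  have "(u, v) \<in> ?R" if "u \<in> \<Union>(set ?es)" "v \<in> \<Union>(set ?es)" for u v
    using sym[OF z0[OF that(1)]] z0[OF that(2)] by (rule rtrancl_trans)
  moreover have "\<Union>(set ?es) \<noteq> {}" by (auto simp: es)
  ultimately show ?thesis
    using fin c2 val unfolding is_gc_graph_def loop_free_def by blast
qed

text \<open>Budget for what is still to be glued: a port may take two more edges, the path end one,
  older vertices none. A new port carries two edges and a new path end three, so the bound
  \<open>4\<close> survives each letter.\<close>

lemma strip_valence_le: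
  assumes B: "\<And>p a k. ports_ok p a k \<Longrightarrow>
      (\<forall>x. valence (B p a k) (p x) \<le> 2) \<and> valence (B p a k) a \<le> 1 \<and>
      (\<forall>z\<ge>k. valence (B p a k) z \<le> 4) \<and>
      (\<forall>z<k. z \<notin> insert a (range p) \<longrightarrow> valence (B p a k) z = 0)"
    and "ports_ok p a k"
  shows "(\<forall>x. valence (strip w p a k B) (p x) \<le> 2) \<and> valence (strip w p a k B) a \<le> 1 \<and>
      (\<forall>z\<ge>k. valence (strip w p a k B) z \<le> 4) \<and>
      (\<forall>z<k. z \<notin> insert a (range p) \<longrightarrow> valence (strip w p a k B) z = 0)"
  using assms(2)
proof (induction w arbitrary: p a k)
  case Nil
  then show ?case using B unfolding strip.simps by blast
next
  case (Cons x w)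
  define q where "q = p(x := k + 1)"
  define T where "T = strip w q k (k + 2) B"
  have S: "strip (x # w) p a k B = [{a, k}, {k, p x}, {k, k + 1}, {p x, k + 1}] @ T"
    by (simp add: T_def q_def)
  have ok: "p x < k" "p (\<not> x) < k" "p x \<noteq> a" "p (\<not> x) \<noteq> a" "a < k" "p x \<noteq> p (\<not> x)"
    using Cons.prems by (cases x; auto simp: ports_ok_def)+
  have "ports_ok q k (k + 2)" unfolding q_def by (rule ports_ok_step[OF Cons.prems])
  note IH = Cons.IH[OF this, folded T_def]
  have T: "valence T (k + 1) \<le> 2" "valence T (p (\<not> x)) \<le> 2" "valence T k \<le> 1"
    "\<And>z. k + 2 \<le> z \<Longrightarrow> valence T z \<le> 4"
    using IH[THEN conjunct1, rule_format, of x] IH[THEN conjunct1, rule_format, of "\<not> x"] IH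
    by (simp_all add: q_def)
  have r: "y = x \<or> y = (\<not> x)" for y by auto
  have z0: "valence T z = 0" if z: "z < k" "z \<noteq> p (\<not> x)" for z
  proof -
    have "q y = k + 1 \<or> q y = p (\<not> x)" for y using r[of y] by (auto simp: q_def)
    then have "z \<notin> insert k (range q)" using z by (metis add_lessD1 imageE insertE nat_neq_iff)
    then show ?thesis using IH z(1) by simp
  qed
  have "valence (strip (x # w) p a k B) (p y) \<le> 2" for y
    using r[of y]
  proof
    assume "y = x"
    then show ?thesis using ok z0[of "p x"] unfolding S by simp
  next
    assume "y = (\<not> x)"
    then show ?thesis using ok T(2) unfolding S by simp
  qed
  moreover have "valence (strip (x # w) p a k B) a \<le> 1"
    using ok z0[of a] unfolding S by simp
  moreover have "valence (strip (x # w) p a k B) z \<le> 4" if "k \<le> z" for z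
  proof -
    have "z = k \<or> z = k + 1 \<or> k + 2 \<le> z" using that by linarith
    then consider "z = k" | "z = k + 1" | "k + 2 \<le> z" by blast
    then show ?thesis
    proof cases
      case 3
      then show ?thesis using T(4)[OF 3] ok unfolding S by simp
    qed (use T(1,3) ok in \<open>auto simp: S simp del: strip.simps\<close>)
  qed
  moreover have "valence (strip (x # w) p a k B) z = 0"
    if z: "z < k" "z \<notin> insert a (range p)" for z
    using z ok z0[of z] unfolding S by auto
  ultimately show ?case by blast
qed

section \<open>Boundary of a blown-up wheel\<close>

abbreviation blown_wheel :: "bool list \<Rightarrow> nat \<Rightarrow> nat set list" where
  "blown_wheel w n \<equiv> closed_strip w (cap n)"

text \<open>Positions of the edges, with \<open>L = length w\<close>: the starting triangle at
  \<open>0\<close> to \<open>2\<close>, letter \<open>j\<close> at \<open>4 * j + 3\<close> to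
  \<open>4 * j + 6\<close> with its path edge first, the path edge of the cap at
  \<open>4 * L + 3\<close>, its fan from \<open>4 * L + 4\<close> to
  \<open>4 * L + 4 + 2 * n\<close>.\<close>

definition contraction :: "bool list \<Rightarrow> nat \<Rightarrow> nat \<Rightarrow> 'k::field_char_0 gc" where
  "contraction w n i = list_class (contract_edges i (blown_wheel w n))"

lemma contraction_triangle:
  assumes "blown_wheel w n ! i = {u, v}" "i < length (blown_wheel w n)"
    and "{u, z} \<in> set (blown_wheel w n)" "{v, z} \<in> set (blown_wheel w n)"
    and "u \<noteq> v" "z \<noteq> u" "z \<noteq> v"
  shows "contraction w n i = 0"
  unfolding contraction_def by (rule list_class_contract_triangle[of i _ u v z]) (use assms in auto)

lemma contraction_start:
  assumes "i < 3"
  shows "contraction w n i = 0"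
proof -
  have "i = 0 \<or> i = 1 \<or> i = 2" using assms by linarith
  then show ?thesis
  proof (elim disjE)
    assume "i = 0"
    then show ?thesis
      by (intro contraction_triangle[of w n i 0 1 2]) (auto simp: closed_strip_def)
  next
    assume "i = 1"
    then show ?thesis
      by (intro contraction_triangle[of w n i 0 2 1]) (auto simp: closed_strip_def insert_commute)
  next
    assume "i = 2"
    then show ?thesis
      by (intro contraction_triangle[of w n i 1 2 0]) (auto simp: closed_strip_def insert_commute)
  qed
qed

lemma blown_wheel_letter:
  obtains ps p a where "length ps = 4 * length u + 3"
    and "blown_wheel (u @ x # v) n = ps @ [{a, 3 + 2 * length u},
      {3 + 2 * length u, p x}, {3 + 2 * length u, 4 + 2 * length u}, {p x, 4 + 2 * length u}] @
      strip v (p(x := 4 + 2 * length u)) (3 + 2 * length u) (5 + 2 * length u) (cap n)"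
    and "ports_ok p a (3 + 2 * length u)"
proof -
  obtain ps p a where *: "length ps = 3 + 4 * length u"
    "\<And>v B. closed_strip (u @ v) B = ps @ strip v p a (3 + 2 * length u) B"
    "ports_ok p a (3 + 2 * length u)"
    using closed_strip_decomp[of u] by metis
  from *(2)[of "x # v" "cap n"] show ?thesis
    by (intro that[of ps a p]) (use * in \<open>simp_all add: add.commute eval_nat_numeral\<close>)
qed

text \<open>The last three edges of a letter form the triangle on \<open>k\<close>,
  \<open>p x\<close> and \<open>k + 1\<close>; the path edge, at \<open>r = 0\<close>, is treated
  separately.\<close>

lemma contraction_letter:
  assumes "j < length w" "0 < r" "r < 4"
  shows "contraction w n (4 * j + 3 + r) = 0"
proof -
  define u x v where "u = take j w" and "x = w ! j" and "v = drop (Suc j) w"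
  have w: "w = u @ x # v" and lu: "length u = j"
    using assms(1) by (simp_all add: u_def x_def v_def id_take_nth_drop)
  obtain ps p a where ps: "length ps = 4 * length u + 3"
    and es: "blown_wheel (u @ x # v) n = ps @ [{a, 3 + 2 * length u},
      {3 + 2 * length u, p x}, {3 + 2 * length u, 4 + 2 * length u}, {p x, 4 + 2 * length u}] @
      strip v (p(x := 4 + 2 * length u)) (3 + 2 * length u) (5 + 2 * length u) (cap n)"
    and ok: "ports_ok p a (3 + 2 * length u)"
    by (rule blown_wheel_letter)
  define k where "k = 3 + 2 * length u"
  define T where "T = strip v (p(x := 4 + 2 * length u)) k (5 + 2 * length u) (cap n)"
  have E: "blown_wheel w n = ps @ [{a, k}, {k, p x}, {k, k + 1}, {p x, k + 1}] @ T"
    by (simp add: w es k_def T_def add.commute)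
  have lt: "p x < k" using ok by (simp add: ports_ok_def k_def)
  have mem: "{k, p x} \<in> set (blown_wheel w n)" "{k, k + 1} \<in> set (blown_wheel w n)"
    "{p x, k + 1} \<in> set (blown_wheel w n)"
    by (simp_all add: E)
  have i: "4 * j + 3 + r = length ps + r" by (simp add: ps lu)
  have nth: "blown_wheel w n ! (length ps + 1) = {k, p x}"
    "blown_wheel w n ! (length ps + 2) = {k, k + 1}"
    "blown_wheel w n ! (length ps + 3) = {p x, k + 1}"
    by (simp_all add: E nth_append eval_nat_numeral)
  have len: "length ps + r < length (blown_wheel w n)"
    using assms(3) by (simp add: E)
  have r: "r = 1 \<or> r = 2 \<or> r = 3" using assms by linarith
  have "contraction w n (length ps + r) = (0 :: 'a gc)"
    using r
  proof (elim disjE)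
    assume "r = 1"
    then show "contraction w n (length ps + r) = (0 :: 'a gc)" using lt len nth mem
      by (intro contraction_triangle[of w n _ k "p x" "k + 1"]) (simp_all add: insert_commute)
  next
    assume "r = 2"
    then show "contraction w n (length ps + r) = (0 :: 'a gc)" using lt len nth mem
      by (intro contraction_triangle[of w n _ k "k + 1" "p x"]) (simp_all add: insert_commute)
  next
    assume "r = 3"
    then show "contraction w n (length ps + r) = (0 :: 'a gc)" using lt len nth mem
      by (intro contraction_triangle[of w n _ "p x" "k + 1" k]) (simp_all add: insert_commute)
  qed
  then show ?thesis by (simp add: i)
qed

text \<open>One prefix and one state serve three ends of the same word: a cap, one more letter with
  a cap, and an arbitrary continuation.\<close>

lemma blown_wheel_cap:
  obtains ps p a where "length ps = 4 * length w + 3"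
    and "\<And>n. blown_wheel w n = ps @ cap n p a (3 + 2 * length w)"
    and "\<And>x n. blown_wheel (w @ [x]) n = ps @ [{a, 3 + 2 * length w},
      {3 + 2 * length w, p x}, {3 + 2 * length w, 4 + 2 * length w}, {p x, 4 + 2 * length w}] @
      cap n (p(x := 4 + 2 * length w)) (3 + 2 * length w) (5 + 2 * length w)"
    and "\<And>B. closed_strip w B = ps @ B p a (3 + 2 * length w)"
    and "\<Union>(set ps) \<subseteq> {..<3 + 2 * length w}" and "ports_ok p a (3 + 2 * length w)"
proof -
  obtain ps p a where *: "length ps = 3 + 4 * length w"
    "\<And>v B. closed_strip (w @ v) B = ps @ strip v p a (3 + 2 * length w) B"
    "\<Union>(set ps) \<subseteq> {..<3 + 2 * length w}" "ports_ok p a (3 + 2 * length w)"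
    using closed_strip_decomp[of w] by metis
  show ?thesis
    by (intro that[of ps p a])
      (use * *(2)[of "[]"] *(2)[of "[_]"] in \<open>simp_all add: add.commute eval_nat_numeral\<close>)
qed

text \<open>A spoke forms a triangle with a neighbouring rim vertex of the fan, an inner rim edge
  with the cap. The range of \<open>t\<close> leaves out the two outer rim edges.\<close>

lemma contraction_fan:
  assumes n: "2 \<le> n" and t: "0 < t" "t < 2 * n"
  shows "contraction w n (4 * length w + 4 + t) = 0"
proof -
  obtain ps p a where ps: "length ps = 4 * length w + 3"
    and es: "\<And>n. blown_wheel w n = ps @ cap n p a (3 + 2 * length w)"
    using blown_wheel_cap[of w] by metis
  define k where "k = 3 + 2 * length w"
  define ys where "ys = [k + 1..<k + 1 + n]"
  define F where "F = fan k (p True) (p False) ys"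
  have ys: "length ys = n" "\<And>j. j < n \<Longrightarrow> ys ! j = k + 1 + j"
    by (simp_all add: ys_def del: upt_Suc)
  have E: "blown_wheel w n = ps @ {a, k} # F"
    by (simp add: es cap_def k_def F_def ys_def del: upt_Suc)
  have len: "length F = 2 * n + 1" by (simp add: F_def ys)
  have nth: "blown_wheel w n ! (4 * length w + 4 + s) = F ! s" for s
    by (simp add: E nth_append ps)
  have lt: "4 * length w + 4 + t < length (blown_wheel w n)" using t by (simp add: E ps len)
  have spoke: "F ! (2 * j + 1) = {k, k + 1 + j}" if "j < n" for j
    using fan_nth_spoke[of j ys k "p True" "p False"] that by (simp add: F_def ys)
  have rim: "F ! (2 * j + 2) = {k + 1 + j, k + 2 + j}" if "Suc j < n" for j
    using fan_nth_rim[of j ys k "p True" "p False"] that by (simp add: F_def ys)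
  have in_spoke: "{k, k + 1 + j} \<in> set (blown_wheel w n)" if "j < n" for j
  proof -
    have "F ! (2 * j + 1) \<in> set F" by (rule nth_mem) (use that len in simp)
    then show ?thesis unfolding spoke[OF that] by (simp add: E)
  qed
  have in_rim: "{k + 1 + j, k + 2 + j} \<in> set (blown_wheel w n)" if "Suc j < n" for j
  proof -
    have "F ! (2 * j + 2) \<in> set F" by (rule nth_mem) (use that len in simp)
    then show ?thesis unfolding rim[OF that] by (simp add: E)
  qed
  show ?thesis
  proof (cases "even t")
    case False
    then obtain j where j: "t = 2 * j + 1" by (rule oddE)
    then have jn: "j < n" using t by simp
    show ?thesis
    proof (cases "Suc j < n")
      case True
      show ?thesis
        by (rule contraction_triangle[of w n _ k "k + 1 + j" "k + 2 + j"])
          (use lt nth[of t] spoke[OF jn] j in_spoke[OF True] in_rim[OF True] in simp_all)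
    next
      case False
      \<comment> \<open>The last spoke has no next rim vertex in the fan and uses the preceding one,
        which \<open>2 \<le> n\<close> provides.\<close>
      then obtain i where i: "j = Suc i" using jn n by (cases j) auto
      then have "Suc i < n" "i < n" using jn by simp_all
      then show ?thesis
        by (intro contraction_triangle[of w n _ k "k + 1 + j" "k + 1 + i"])
          (use lt nth[of t] spoke[OF jn] j i in_spoke[of i] in_rim[of i] in
            \<open>simp_all add: insert_commute\<close>)
    qed
  next
    case True
    then obtain j' where j': "t = 2 * j'" by (rule evenE)
    then obtain j where j: "t = 2 * j + 2" using t by (cases j') auto
    then have jn: "Suc j < n" "j < n" using t by simp_all
    show ?thesis
      by (rule contraction_triangle[of w n _ "k + 1 + j" "k + 2 + j" k])
        (use lt nth[of t] rim[OF jn(1)] j in_spoke[OF jn(1)] in_spoke[OF jn(2)] in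
          \<open>simp_all add: insert_commute\<close>)
  qed
qed

text \<open>\<open>?A\<close> holds the path edge and the two outer rim edges at the cap,
  \<open>?B\<close> the path edges of the letters; all other edges lie in triangles. The number of
  edges is odd, so odd positions count positively.\<close>

lemma gc_boundary_blown_wheel:
  assumes n: "2 \<le> n"
  shows "\<partial> (list_class (blown_wheel w n) :: 'k::field_char_0 gc) =
    contraction w n (4 * length w + 3) - contraction w n (4 * length w + 4) -
    contraction w n (4 * length w + 4 + 2 * n) + (\<Sum>j<length w. contraction w n (4 * j + 3))"
proof -
  let ?L = "length w" and ?E = "4 * length w + 2 * n + 5"
  define g :: "nat \<Rightarrow> 'k gc" where
    "g i = gc_scale ((-1) ^ (i + ?E)) (contraction w n i)" for i
  let ?A = "{4 * ?L + 3, 4 * ?L + 4, 4 * ?L + 4 + 2 * n}" and ?B = "(\<lambda>j. 4 * j + 3) ` {..<?L}"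
  have z: "contraction w n i = (0 :: 'k gc)" if i: "i < ?E" "i \<notin> ?A \<union> ?B" for i
  proof -
    have "i < 3 \<or> (3 \<le> i \<and> i < 4 * ?L + 3) \<or> (4 * ?L + 4 < i \<and> i < 4 * ?L + 4 + 2 * n)"
      using i by auto
    then show ?thesis
    proof (elim disjE conjE)
      assume "i < 3"
      then show ?thesis by (rule contraction_start)
    next
      assume b: "3 \<le> i" "i < 4 * ?L + 3"
      define j r where "j = (i - 3) div 4" and "r = (i - 3) mod 4"
      have ijr: "i = 4 * j + 3 + r" using b by (simp add: j_def r_def)
      have "j < ?L" using b by (auto simp: j_def)
      moreover have "r \<noteq> 0"
      proof
        assume "r = 0"
        then have "i \<in> ?B" using ijr \<open>j < ?L\<close> by simp
        then show False using i by simp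
      qed
      ultimately show ?thesis unfolding ijr by (intro contraction_letter) (simp_all add: r_def)
    next
      assume b: "4 * ?L + 4 < i" "i < 4 * ?L + 4 + 2 * n"
      define t where "t = i - (4 * ?L + 4)"
      have "i = 4 * ?L + 4 + t" using b by (simp add: t_def)
      then show ?thesis using b n by (auto intro!: contraction_fan)
    qed
  qed
  have "\<partial> (list_class (blown_wheel w n) :: 'k gc) = (\<Sum>i<?E. g i)"
    using gc_boundary_list_class[OF is_gc_graph_closed_strip_cap[OF n, of w], where ?'k = 'k]
    by (simp add: length_closed_strip_cap g_def contraction_def)
  also have "\<dots> = sum g (?A \<union> ?B)"
    by (rule sum.mono_neutral_right) (use z in \<open>auto simp: g_def\<close>)
  also have "\<dots> = sum g ?A + sum g ?B" by (intro sum.union_disjoint) auto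
  also have "sum g ?B = (\<Sum>j<?L. g (4 * j + 3))"
    by (subst sum.reindex) (auto simp: inj_on_def)
  finally show ?thesis using n by (simp add: g_def minus_one_power_iff)
qed

section \<open>Cancellation of contracted path edges\<close>

text \<open>Merging \<open>k\<close> and \<open>k + 2\<close> gives one path vertex with the
  triangles of both letters. As the letters differ, each triangle hangs on an old port, so the two
  blocks of three edges look alike.\<close>

lemma contraction_two_letters:
  assumes ps: "\<And>v B. closed_strip (u @ v) B = ps @ strip v p a k B" "length ps = 3 + 4 * length u"
    and k: "\<Union>(set ps) \<subseteq> {..<k}" and ok: "ports_ok p a k" and xy: "x \<noteq> y"
  shows "contraction (u @ x # y # v) n (4 * length u + 7) = list_class
    (ps @ [{a, k}, {k, p x}, {k, k + 1}, {p x, k + 1}, {k, p y}, {k, k + 3}, {p y, k + 3}] @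
      strip v (p(x := k + 1, y := k + 3)) k (k + 4) (cap n))"
proof -
  define q where "q = p(x := k + 1, y := k + 3)"
  define m where "m = merge {k, k + 2}"
  have m: "m z = (if z = k + 2 then k else z)" for z by (simp add: m_def merge_def)
  have lt: "p z < k" "a < k" for z using ok by (auto simp: ports_ok_def)
  have es: "blown_wheel (u @ x # y # v) n =
      (ps @ [{a, k}, {k, p x}, {k, k + 1}, {p x, k + 1}]) @ {k, k + 2} #
      ([{k + 2, p y}, {k + 2, k + 3}, {p y, k + 3}] @ strip v q (k + 2) (k + 4) (cap n))"
    unfolding ps(1) using xy by (simp add: q_def eval_nat_numeral)
  have mp: "m \<circ> q = q" using lt(1) xy by (fastforce simp: fun_eq_iff m q_def)
  have "map ((`) m) (strip v q (k + 2) (k + 4) (cap n)) =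
      strip v (m \<circ> q) (m (k + 2)) (k + 4) (cap n)"
    by (rule strip_relabel) (simp add: m)
  then have tail: "map ((`) m) (strip v q (k + 2) (k + 4) (cap n)) = strip v q k (k + 4) (cap n)"
    unfolding mp by (simp add: m)
  have "m z = z" if "z \<in> \<Union>(set ps)" for z using that k by (auto simp: m)
  then have pre: "map ((`) m) ps = ps" by (rule map_image_fix)
  have mz: "m a = a" "m k = k" "m (Suc k) = Suc k" "m (Suc (Suc k)) = k" "m (k + 3) = k + 3"
    "m (p x) = p x" "m (p y) = p y"
    using lt(1)[of x] lt(1)[of y] lt(2) by (simp_all add: m)
  have i: "4 * length u + 7 = length (ps @ [{a, k}, {k, p x}, {k, k + 1}, {p x, k + 1}])"
    by (simp add: ps(2))
  have "contract_edges (4 * length u + 7) (blown_wheel (u @ x # y # v) n) =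
      ps @ [{a, k}, {k, p x}, {k, k + 1}, {p x, k + 1}, {k, p y}, {k, k + 3}, {p y, k + 3}] @
      strip v q k (k + 4) (cap n)"
    unfolding es contract_edges_nth[OF i] m_def[symmetric] map_append pre tail
    by (simp add: mz insert_commute)
  then show ?thesis by (simp add: contraction_def q_def)
qed

lemma inj_on_transpose: "inj_on (transpose i j) A"
  by (rule inj_onI) (metis transpose_involutory)

text \<open>For equal letters the path edge lies in a triangle and both sides vanish. For unequal
  ones the contracted graphs agree up to exchanging the two blocks of three edges, an odd
  permutation.\<close>

lemma contraction_swap_letters:
  "contraction (u @ x # y # v) n (4 * length u + 7) =
    - (contraction (u @ y # x # v) n (4 * length u + 7) :: 'k::field_char_0 gc)"
proof -
  define k where "k = 3 + 2 * length u"
  obtain ps p a where ps: "length ps = 3 + 4 * length u"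
      "\<And>v B. closed_strip (u @ v) B = ps @ strip v p a k B"
    and k: "\<Union>(set ps) \<subseteq> {..<k}" and ok: "ports_ok p a k"
    using closed_strip_decomp[of u] unfolding k_def by metis
  have lt: "p z < k" "a < k" for z using ok by (auto simp: ports_ok_def)
  show ?thesis
  proof (cases "x = y")
    case True
    have "blown_wheel (u @ x # x # v) n =
      (ps @ [{a, k}, {k, p x}, {k, k + 1}, {p x, k + 1}]) @ {k, k + 2} #
      ([{k + 2, k + 1}, {k + 2, k + 3}, {k + 1, k + 3}] @
        strip v (p(x := k + 3)) (k + 2) (k + 4) (cap n))"
      unfolding ps(2) by (simp add: eval_nat_numeral)
    moreover from this have "blown_wheel (u @ x # x # v) n ! (4 * length u + 7) = {k, k + 2}"
      by (simp add: nth_append ps(1))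
    ultimately have "contraction (u @ x # x # v) n (4 * length u + 7) = (0 :: 'k gc)"
      by (intro contraction_triangle[of _ n _ k "k + 2" "k + 1"]) (simp_all add: ps(1))
    then show ?thesis using True by simp
  next
    case False
    \<comment> \<open>Exchanges the rim vertices of the two letters, which are numbered in the order
      of the word.\<close>
    define f where "f = transpose (k + 1) (k + 3)"
    have f: "f z = z" if "z < k + 1 \<or> k + 4 \<le> z \<or> z = k" for z
      using that by (auto simp: f_def transpose_def)
    have f13: "f (k + 1) = k + 3" "f (k + 3) = k + 1" by (simp_all add: f_def transpose_def)
    define A where "A = [{k, p x}, {k, k + 1}, {p x, k + 1}]"
    define B where "B = [{k, p y}, {k, k + 3}, {p y, k + 3}]"
    define T where "T = strip v (p(x := k + 1, y := k + 3)) k (k + 4) (cap n)"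
    have xy: "contraction (u @ x # y # v) n (4 * length u + 7) =
        (list_class ((ps @ [{a, k}]) @ A @ B @ T) :: 'k gc)"
      unfolding contraction_two_letters[OF ps(2,1) k ok False] by (simp add: A_def B_def T_def)
    have "f \<circ> p(y := k + 1, x := k + 3) = p(x := k + 1, y := k + 3)"
    proof
      fix z
      have "z = x \<or> z = y" using False by auto
      then show "(f \<circ> p(y := k + 1, x := k + 3)) z = (p(x := k + 1, y := k + 3)) z"
        using False f13 by auto
    qed
    moreover have "map ((`) f) (strip v (p(y := k + 1, x := k + 3)) k (k + 4) (cap n)) =
        strip v (f \<circ> p(y := k + 1, x := k + 3)) (f k) (k + 4) (cap n)"
      by (rule strip_relabel) (simp add: f)
    ultimately have tail:
      "map ((`) f) (strip v (p(y := k + 1, x := k + 3)) k (k + 4) (cap n)) = T"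
      by (simp add: T_def f)
    have pre: "map ((`) f) ps = ps"
    proof (rule map_image_fix)
      fix z assume "z \<in> \<Union>(set ps)"
      then have "z < k" using k by auto
      then show "f z = z" by (simp add: f)
    qed
    have fp: "f (p x) = p x" "f (p y) = p y" "f a = a" "f k = k"
      using lt(1)[of x] lt(1)[of y] lt(2) by (simp_all add: f)
    have "contraction (u @ y # x # v) n (4 * length u + 7) =
      (list_class (ps @ [{a, k}, {k, p y}, {k, k + 1}, {p y, k + 1}, {k, p x}, {k, k + 3}, {p x, k + 3}] @
        strip v (p(y := k + 1, x := k + 3)) k (k + 4) (cap n)) :: 'k gc)"
      using contraction_two_letters[OF ps(2,1) k ok False[symmetric]] .
    also have "\<dots> = list_class (map ((`) f) (ps @ [{a, k}, {k, p y}, {k, k + 1}, {p y, k + 1},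
        {k, p x}, {k, k + 3}, {p x, k + 3}] @
        strip v (p(y := k + 1, x := k + 3)) k (k + 4) (cap n)))"
      unfolding f_def by (rule list_class_relabel[symmetric]) (rule inj_on_transpose)
    also have "map ((`) f) (ps @ [{a, k}, {k, p y}, {k, k + 1}, {p y, k + 1},
        {k, p x}, {k, k + 3}, {p x, k + 3}] @
        strip v (p(y := k + 1, x := k + 3)) k (k + 4) (cap n)) = (ps @ [{a, k}]) @ B @ A @ T"
      unfolding map_append pre tail using f13 by (simp add: fp A_def B_def)
    \<comment> \<open>Three edges pass three edges: nine swaps, hence the minus sign.\<close>
    also have "list_class ((ps @ [{a, k}]) @ B @ A @ T) =
        - (list_class ((ps @ [{a, k}]) @ A @ B @ T) :: 'k gc)"
      using list_class_move_triple[of "ps @ [{a, k}]" B "{k, p x}" "{k, k + 1}" "{p x, k + 1}" T,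
        where ?'k = 'k]
      by (simp add: A_def B_def)
    finally show ?thesis unfolding xy by simp
  qed
qed

text \<open>Exchanging the letters \<open>j - 1\<close> and \<open>j\<close> is an involution on
  words that reverses the sign, so the sum equals its negative. For \<open>j = 0\<close> the path
  edge lies in a triangle with the port of the first letter.\<close>

lemma sum_contraction_spine:
  assumes "j < L"
  shows "(\<Sum>w | length w = L. contraction w n (4 * j + 3)) = (0 :: 'k::field_char_0 gc)"
proof (cases j)
  case 0
  have "contraction w n 3 = (0 :: 'k gc)" if "length w = L" for w
  proof -
    have "w \<noteq> []" using that assms by auto
    then obtain x v where w: "w = x # v" by (cases w) auto
    have "blown_wheel w n ! 3 = {0, 3}" "3 < length (blown_wheel w n)"
      by (simp_all add: w closed_strip_def)
    then show ?thesis
      by (rule contraction_triangle[where z = "if x then 1 else 2"])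
        (auto simp: w closed_strip_def insert_commute)
  qed
  then show ?thesis using 0 by simp
next
  case (Suc i)
  define s where "s w = w[i := w ! Suc i, Suc i := w ! i]" for w :: "bool list"
  let ?W = "{w :: bool list. length w = L}"
  have neg: "contraction (s w) n (4 * j + 3) = - (contraction w n (4 * j + 3) :: 'k gc)"
    if w: "length w = L" for w
  proof -
    define u v where "u = take i w" and "v = drop (Suc (Suc i)) w"
    have lu: "length u = i" using w assms Suc by (simp add: u_def)
    have W: "w = u @ w ! i # w ! Suc i # v"
      using w assms Suc by (simp add: u_def v_def Cons_nth_drop_Suc)
    have "s w = u @ w ! Suc i # w ! i # v"
      unfolding s_def by (subst (1) W) (simp add: list_update_append lu)
    moreover have "4 * j + 3 = 4 * length u + 7" by (simp add: Suc lu)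
    ultimately show ?thesis
      using contraction_swap_letters[of u "w ! Suc i" "w ! i" v n, where ?'k = 'k]
      unfolding W[symmetric] by (simp only:)
  qed
  have "s (s w) = w" if "length w = L" for w
    using that assms Suc by (auto simp: s_def list_eq_iff_nth_eq nth_list_update)
  then have "(\<Sum>w\<in>?W. contraction w n (4 * j + 3)) =
      (\<Sum>w\<in>?W. contraction (s w) n (4 * j + 3) :: 'k gc)"
    by (intro sum.reindex_bij_witness[of _ s s]) (auto simp: s_def)
  also have "\<dots> = - (\<Sum>w\<in>?W. contraction w n (4 * j + 3))"
    using neg by (simp add: sum_negf)
  finally have "gc_scale (1 + 1) (\<Sum>w\<in>?W. contraction w n (4 * j + 3) :: 'k gc) = 0"
    by (simp only: gc.scale_left_distrib gc.scale_one) (simp add: eq_neg_iff_add_eq_0)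
  then show ?thesis by simp
qed

text \<open>The cap after contraction of the rim edge on side \<open>x\<close> of its fan.\<close>

definition cut_cap :: "bool \<Rightarrow> nat \<Rightarrow> (bool \<Rightarrow> nat) \<Rightarrow> nat \<Rightarrow> nat \<Rightarrow> nat set list" where
  "cut_cap x n p a k = {a, k} #
     (if x then {k, p True} # fan k (p True) (p False) [k + 2..<k + 1 + n]
      else fan k (p True) (p False) [k + 1..<k + n] @ [{k, p False}])"

section \<open>Matching the contractions at the cap\<close>

text \<open>The outermost rim vertex of the fan on side \<open>x\<close> merges into the port, and
  its spoke becomes an edge from the cap to the port. Side \<open>True\<close> is the head of the
  fan list, side \<open>False\<close> its end, exposed by \<open>fan_snoc\<close>.\<close>

lemma contraction_rim:
  assumes n: "1 \<le> n"
  shows "contraction w n (if x then 4 * length w + 4 else 4 * length w + 4 + 2 * n) =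
    list_class (closed_strip w (cut_cap x n))"
proof -
  define k where "k = 3 + 2 * length w"
  obtain ps p a where ps: "length ps = 4 * length w + 3"
    and B: "\<And>B. closed_strip w B = ps @ B p a k"
    and k: "\<Union>(set ps) \<subseteq> {..<k}" and ok: "ports_ok p a k"
    using blown_wheel_cap[of w] unfolding k_def by metis
  have lt: "p z < k" "a < k" for z using ok by (auto simp: ports_ok_def)
  show ?thesis
  proof (cases x)
    case True
    define ys where "ys = [k + 2..<k + 1 + n]"
    define m where "m = merge {p True, k + 1}"
    have m: "m z = (if z = k + 1 then p True else z)" for z
      using lt(1)[of True] by (auto simp: m_def merge_def)
    have "[k + 1..<k + 1 + n] = (k + 1) # ys"
      using n by (subst upt_conv_Cons) (auto simp: ys_def)
    then have E: "blown_wheel w n = (ps @ [{a, k}]) @ {p True, k + 1} #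
        ({k, k + 1} # fan k (k + 1) (p False) ys)"
      by (simp add: B cap_def del: upt_Suc)
    have i: "4 * length w + 4 = length (ps @ [{a, k}])" by (simp add: ps)
    have pre: "map ((`) m) ps = ps"
    proof (rule map_image_fix)
      fix z assume "z \<in> \<Union>(set ps)"
      then have "z < k" using k by auto
      then show "m z = z" by (simp add: m)
    qed
    have ys: "map m ys = ys" by (rule map_idI) (auto simp: ys_def m)
    have mz: "m a = a" "m k = k" "m (Suc k) = p True" "m (p False) = p False"
      using lt(1)[of False] lt(2) by (simp_all add: m)
    have "closed_strip w (cut_cap x n) =
        ps @ {a, k} # {k, p True} # fan k (p True) (p False) ys"
      unfolding B cut_cap_def ys_def using True by simp
    moreover have "contract_edges (4 * length w + 4) (blown_wheel w n) =
        ps @ {a, k} # {k, p True} # fan k (p True) (p False) ys"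
      unfolding E i contract_edges_nth[OF refl] m_def[symmetric] map_append pre
      by (simp add: ys mz map_fan)
    ultimately show ?thesis using True by (simp add: contraction_def)
  next
    case False
    define ys where "ys = [k + 1..<k + n]"
    define m where "m = merge {k + n, p False}"
    have m: "m z = (if z = k + n then p False else z)" for z
      using lt(1)[of False] by (auto simp: m_def merge_def)
    have "[k + 1..<k + 1 + n] = ys @ [k + n]" using n by (simp add: ys_def)
    then have E: "blown_wheel w n =
        (ps @ {a, k} # fan k (p True) (k + n) ys @ [{k, k + n}]) @ {k + n, p False} # []"
      by (simp add: B cap_def fan_snoc del: upt_Suc)
    have i: "4 * length w + 4 + 2 * n =
        length (ps @ {a, k} # fan k (p True) (k + n) ys @ [{k, k + n}])"
      using n by (simp add: ps ys_def)
    have pre: "map ((`) m) ps = ps"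
    proof (rule map_image_fix)
      fix z assume "z \<in> \<Union>(set ps)"
      then have "z < k" using k by auto
      then show "m z = z" by (simp add: m)
    qed
    have ys: "map m ys = ys" by (rule map_idI) (auto simp: ys_def m)
    have mz: "m a = a" "m k = k" "m (k + n) = p False" "m (p True) = p True"
      using lt(1)[of True] lt(2) n by (simp_all add: m)
    have "closed_strip w (cut_cap x n) =
        ps @ {a, k} # fan k (p True) (p False) ys @ [{k, p False}]"
      unfolding B cut_cap_def ys_def using False by simp
    moreover have "contract_edges (4 * length w + 4 + 2 * n) (blown_wheel w n) =
        ps @ {a, k} # fan k (p True) (p False) ys @ [{k, p False}]"
      unfolding E i contract_edges_nth[OF refl] m_def[symmetric] map_append pre
      by (simp add: pre ys mz map_fan)
    ultimately show ?thesis using False by (simp add: contraction_def)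
  qed
qed

text \<open>Both contractions leave a cap joined to the port \<open>p x\<close> and to
  \<open>n + 1\<close> further rim vertices; for the longer word one of these is the rim vertex of
  its last letter. The sign comes from the order of the edges.\<close>

lemma contraction_hub_append:
  "contraction (w @ [x]) n (4 * length w + 7) =
    - (contraction w (n + 2) (if x then 4 * length w + 4 else 4 * length w + 4 + 2 * (n + 2))
        :: 'k::field_char_0 gc)"
proof -
  define k where "k = 3 + 2 * length w"
  have kk: "4 + 2 * length w = k + 1" "5 + 2 * length w = k + 2" by (simp_all add: k_def)
  obtain ps p a where ps: "length ps = 4 * length w + 3"
    and es: "\<And>x n. blown_wheel (w @ [x]) n =
      ps @ [{a, k}, {k, p x}, {k, k + 1}, {p x, k + 1}] @ cap n (p(x := k + 1)) k (k + 2)"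
    and B: "\<And>B. closed_strip w B = ps @ B p a k"
    and k: "\<Union>(set ps) \<subseteq> {..<k}" and ok: "ports_ok p a k"
    using blown_wheel_cap[of w, folded k_def, unfolded kk] by metis
  have lt: "p z < k" "a < k" for z using ok by (auto simp: ports_ok_def)
  define q where "q = p(x := k + 1)"
  define Y where "Y = [k + 3..<k + 3 + n]"
  have Y: "set Y = {k + 3..<k + 3 + n}" by (simp add: Y_def del: upt_Suc)
  define l where "l = ps @ [{a, k}, {k, p x}, {k, k + 1}, {p x, k + 1}] @ fan k (q True) (q False) Y"
  define m where "m = merge {k, k + 2}"
  have m: "m z = (if z = k + 2 then k else z)" for z by (auto simp: m_def merge_def)
  have pre: "map ((`) f) ps = ps" if "\<And>z. z < k \<Longrightarrow> f z = z" for f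
  proof (rule map_image_fix)
    fix z assume "z \<in> \<Union>(set ps)"
    then have "z < k" using k by auto
    then show "f z = z" by (rule that)
  qed
  have i: "4 * length w + 7 = length (ps @ [{a, k}, {k, p x}, {k, k + 1}, {p x, k + 1}])"
    by (simp add: ps)
  have E: "blown_wheel (w @ [x]) n = (ps @ [{a, k}, {k, p x}, {k, k + 1}, {p x, k + 1}]) @
      {k, k + 2} # fan (k + 2) (q True) (q False) Y"
    by (simp add: es cap_def q_def Y_def eval_nat_numeral del: upt_Suc)
  have mY: "map m Y = Y" by (rule map_idI) (auto simp: Y m)
  have mp: "map ((`) m) ps = ps" by (rule pre) (simp add: m)
  have q_neq: "m (q z) = q z" for z using lt(1)[of z] by (cases "z = x") (simp_all add: m q_def)
  have mz: "m a = a" "m k = k" "m (Suc k) = Suc k" "m (Suc (Suc k)) = k" "m (p x) = p x"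
    using lt(1)[of x] lt(2) by (simp_all add: m)
  have hub: "contraction (w @ [x]) n (4 * length w + 7) = (list_class l :: 'k gc)"
    unfolding contraction_def E i contract_edges_nth[OF refl] m_def[symmetric] map_append map_fan mp
    by (simp add: mY q_neq mz l_def)
  have ps_lt: "z < k" if "z \<in> \<Union>(set ps)" for z using that k by auto
  have verts: "z \<noteq> k + 2 \<and> z < k + 3 + n" if "z \<in> \<Union>(set l)" for z
  proof -
    have "q y < k + 2" for y using lt(1)[of y] by (cases "y = x") (simp_all add: q_def)
    then have q: "q True < k + 2" "q False < k + 2" by blast+
    have "z \<in> \<Union>(set ps) \<or> z \<in> {a, k, p x, k + 1} \<or> z \<in> \<Union>(set (fan k (q True) (q False) Y))"
      using that unfolding l_def by auto
    then have "z \<in> \<Union>(set ps) \<or> z \<in> {a, k, p x, k + 1, q True, q False} \<or> z \<in> set Y"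
      using fan_verts[of k "q True" "q False" Y] by blast
    then have "z < k + 2 \<or> z \<in> set Y"
      using ps_lt[of z] lt(1)[of x] lt(2) q by (elim disjE insertE) simp_all
    then show ?thesis by (auto simp: Y)
  qed
  show ?thesis
  proof (cases x)
    case True
    \<comment> \<open>The number \<open>k + 2\<close> is free after the merge; the rim vertex
      \<open>k + 1\<close> of the letter takes it and becomes the first of the fan.\<close>
    define f where "f z = (if z = k + 1 then k + 2 else z)" for z
    have inj: "inj_on f (\<Union>(set l))" using verts by (intro inj_onI) (auto simp: f_def split: if_splits)
    have fY: "map f Y = Y" by (rule map_idI) (auto simp: Y f_def)
    have fp: "map ((`) f) ps = ps" by (rule pre) (simp add: f_def)
    have fz: "f a = a" "f k = k" "f (Suc k) = k + 2" "f (p True) = p True" "f (p False) = p False"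
      using lt(1)[of True] lt(1)[of False] lt(2) by (simp_all add: f_def)
    have fl: "map ((`) f) l = (ps @ [{a, k}, {k, p True}]) @ {k, k + 2} # {p True, k + 2} #
        fan k (k + 2) (p False) Y"
      using True by (simp add: l_def map_fan fp fY fz q_def)
    have "[k + 2..<k + 1 + (n + 2)] = (k + 2) # Y"
      by (subst upt_conv_Cons) (simp_all add: Y_def eval_nat_numeral del: upt_Suc)
    then have "closed_strip w (cut_cap True (n + 2)) = (ps @ [{a, k}, {k, p True}]) @
        {p True, k + 2} # {k, k + 2} # fan k (k + 2) (p False) Y"
      by (simp add: B cut_cap_def del: upt_Suc)
    then have "contraction w (n + 2) (4 * length w + 4) = - (list_class (map ((`) f) l) :: 'k gc)"
      using contraction_rim[of "n + 2" w True, where ?'a = 'k]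
        list_class_swap[of "ps @ [{a, k}, {k, p True}]" "{p True, k + 2}" "{k, k + 2}"
          "fan k (k + 2) (p False) Y", where ?'k = 'k]
      by (simp only: fl if_True)
    then show ?thesis using True hub list_class_relabel[OF inj, where ?'k = 'k] by simp
  next
    case False
    \<comment> \<open>Here the rim vertex of the letter becomes the last of the fan, and the numbers
      in \<open>Y\<close> drop by two to close the gap.\<close>
    define f where "f z = (if z \<le> k then z else if z = k + 1 then k + n + 1 else z - 2)" for z
    have inj: "inj_on f (\<Union>(set l))"
    proof (rule inj_onI)
      fix y z assume "y \<in> \<Union>(set l)" "z \<in> \<Union>(set l)" "f y = f z"
      then show "y = z" using verts[of y] verts[of z] by (auto simp: f_def split: if_splits)
    qed
    define Z where "Z = [k + 1..<k + 1 + n]"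
    have fY: "map f Y = Z"
      by (rule nth_equalityI) (simp_all add: Y_def Z_def f_def del: upt_Suc)
    have fp: "map ((`) f) ps = ps" by (rule pre) (simp add: f_def)
    have fz: "f a = a" "f k = k" "f (Suc k) = k + n + 1" "f (p True) = p True" "f (p False) = p False"
      using lt(1)[of True] lt(1)[of False] lt(2) by (simp_all add: f_def)
    let ?A = "{k, k + n + 1}" and ?B = "{p False, k + n + 1}" and ?C = "{k, p False}"
    let ?F = "fan k (p True) (k + n + 1) Z"
    have fl: "map ((`) f) l = (ps @ [{a, k}]) @ ?C # [?A, ?B] @ ?F"
      using False by (simp add: l_def map_fan fp fY fz q_def)
    have "[k + 1..<k + (n + 2)] = Z @ [k + n + 1]" by (simp add: Z_def)
    then have "closed_strip w (cut_cap False (n + 2)) = (ps @ [{a, k}]) @ ?F @ [?A, ?B, ?C] @ []"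
      by (simp add: B cut_cap_def fan_snoc insert_commute del: upt_Suc)
    then have "contraction w (n + 2) (4 * length w + 4 + 2 * (n + 2)) =
        (list_class ((ps @ [{a, k}]) @ ?F @ [?A, ?B, ?C] @ []) :: 'k gc)"
      using contraction_rim[of "n + 2" w False, where ?'a = 'k] by (simp only: if_False)
    \<comment> \<open>\<open>?F\<close> has \<open>2 * n + 1\<close> edges, so the triple passes it
      with sign \<open>-1\<close>; afterwards \<open>?C\<close> passes two edges without a
      sign.\<close>
    also have "\<dots> = - list_class ((ps @ [{a, k}]) @ [?A, ?B] @ ?C # ?F)"
      unfolding list_class_move_triple by simp
    also have "list_class ((ps @ [{a, k}]) @ [?A, ?B] @ ?C # ?F) =
        (list_class (map ((`) f) l) :: 'k gc)"
      unfolding list_class_move fl by simp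
    finally show ?thesis using False hub list_class_relabel[OF inj, where ?'k = 'k] by simp
  qed
qed

section \<open>Valences at the end of the telescope\<close>

lemma list_class_low_valence:
  assumes "\<And>z. valence es z \<le> 4"
  shows "list_class es \<in> gc.span (gc_class ` Collect low_valence)"
proof (cases "is_gc_graph (\<Union>(set es)) es")
  case True
  then obtain G where G: "verts G = \<Union>(set es)" "edges G = es" by (rule gc_graph_exists)
  have "valence es v = 3 \<or> valence es v = 4" if "v \<in> \<Union>(set es)" for v
  proof -
    have "3 \<le> valence es v" using True that unfolding is_gc_graph_def by blast
    then show ?thesis using assms[of v] by linarith
  qed
  then have "low_valence G" by (simp add: low_valence_def G)
  then show ?thesis using list_class_edges[of G] by (auto simp: G intro!: gc.span_base)
next
  case False
  then show ?thesis by (simp add: list_class_def gc.span_zero)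
qed

text \<open>With three fan vertices, one of them merged into a port, the cap has valence
  \<open>4\<close>: path edge, port and two rim vertices.\<close>

lemma valence_closed_strip_cut_cap: "valence (closed_strip w (cut_cap x 3)) z \<le> 4"
proof -
  let ?Q = "\<lambda>T p a k. (\<forall>x. valence T (p x) \<le> 2) \<and> valence T a \<le> 1 \<and>
      (\<forall>z\<ge>k. valence T z \<le> 4) \<and> (\<forall>z<k. z \<notin> insert a (range p) \<longrightarrow> valence T z = 0)"
  have base: "?Q (cut_cap x 3 p a k) p a k" if "ports_ok p a k" for p a k
  proof -
    have lt: "p True < k" "p False < k" "p True \<noteq> a" "p False \<noteq> a" "p True \<noteq> p False" "a < k"
      using that by (auto simp: ports_ok_def)
    have r: "insert a (range p) = {a, p True, p False}" by (auto simp: UNIV_bool)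
    have u: "[k + 2..<k + 1 + 3] = [k + 2, k + 3]" "[k + 1..<k + 3] = [k + 1, k + 2]"
      by (simp_all add: upt_rec)
    show ?thesis
      unfolding cut_cap_def u r all_bool_eq using lt by auto
  qed
  have p: "range (\<lambda>x. if x then 1 else 2 :: nat) = {1, 2}" by (auto simp: UNIV_bool)
  note V = strip_valence_le[of "cut_cap x 3", OF base ports_ok_start, of w, unfolded all_bool_eq p]
  consider "z = 0" | "z = 1" | "z = 2" | "3 \<le> z" by fastforce
  then show ?thesis
    by cases (use V in \<open>auto simp: closed_strip_def\<close>)
qed

section \<open>The wheel\<close>

lemma set_fan_upt:
  "set (fan c u v [u + 1..<u + 1 + n]) =
     insert {u + n, v} ((\<lambda>i. {i, i + 1}) ` {u..<u + n} \<union> (\<lambda>i. {c, i}) ` {u + 1..<u + 1 + n})"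
proof (induction n arbitrary: v)
  case (Suc n)
  have u: "[u + 1..<u + 1 + Suc n] = [u + 1..<u + 1 + n] @ [u + n + 1]"
    "{u..<u + Suc n} = insert (u + n) {u..<u + n}"
    "{u + 1..<u + 1 + Suc n} = insert (u + n + 1) {u + 1..<u + 1 + n}" by auto
  have s: "insert a (A \<union> B) \<union> {b, d} = insert d (insert a A \<union> insert b B)"
    for a b d and A B :: "nat set set"
    by auto
  show ?case unfolding u fan_snoc set_append Suc.IH image_insert list.set s by simp
qed simp

text \<open>The starting triangle supplies the spokes to \<open>0\<close> and \<open>n + 1\<close>
  and the rim edge closing the cycle; the fan supplies the rest.\<close>

lemma wheel_edges_fan:
  "wheel_edges (n + 2) =
     set ([{n + 2, 0}, {n + 2, n + 1}, {0, n + 1}] @ fan (n + 2) 0 (n + 1) [1..<n + 1])"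
proof -
  have N: "{..<n + 2} = insert (n + 1) {..<n + 1}" by auto
  have "(\<lambda>i. {i, Suc i mod (n + 2)}) ` {..<n + 2} = insert {n + 1, 0} ((\<lambda>i. {i, i + 1}) ` {..<n + 1})"
    unfolding N image_insert by (intro arg_cong2[of _ _ _ _ insert] image_cong) simp_all
  also have "{..<n + 1} = insert n {0..<n}" by auto
  finally have rim: "(\<lambda>i. {i, Suc i mod (n + 2)}) ` {..<n + 2} =
      insert {n + 1, 0} (insert {n, n + 1} ((\<lambda>i. {i, i + 1}) ` {0..<n}))" by simp
  have "{..<n + 2} = insert 0 (insert (n + 1) {1..<n + 1})" by auto
  then have "(\<lambda>i. {i, n + 2}) ` {..<n + 2} =
      insert {0, n + 2} (insert {n + 1, n + 2} ((\<lambda>i. {n + 2, i}) ` {1..<n + 1}))"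
    by (simp add: insert_commute)
  moreover have "set (fan (n + 2) 0 (n + 1) [1..<n + 1]) =
      insert {n, n + 1} ((\<lambda>i. {i, i + 1}) ` {0..<n} \<union> (\<lambda>i. {n + 2, i}) ` {1..<n + 1})"
    using set_fan_upt[of "n + 2" 0 "n + 1" n] by (simp add: add.commute)
  ultimately show ?thesis
    unfolding wheel_edges_def rim by (auto simp: insert_commute)
qed

text \<open>For the empty word, contracting the path edge \<open>{0, 3}\<close> restores the hub.
  The sign stays open because the edges of \<open>W\<close> come in any order.\<close>

lemma wheel_class_contraction:
  assumes n: "1 \<le> n" and W: "is_wheel (n + 2) W"
  shows "gc_class W = (contraction [] n 3 :: 'k::field_char_0 gc) \<or>
    gc_class W = - (contraction [] n 3 :: 'k gc)"
proof -
  define ys where "ys = [4..<4 + n]"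
  define l where "l = [{0, 1}, {0, 2}, {1, 2}] @ fan 0 1 2 ys"
  \<comment> \<open>The hub \<open>0\<close> goes to \<open>n + 2\<close>; the rim, read as
    \<open>1\<close>, \<open>4\<close>, ..., \<open>n + 3\<close>, \<open>2\<close>, goes to
    \<open>0\<close>, ..., \<open>n + 1\<close>.\<close>
  define f where "f z = (if z = 0 then n + 2 else if z = 1 then 0 else if z = 2 then n + 1 else z - 3)"
    for z :: nat
  define m where "m = merge {0, 3}"
  have m: "m z = (if z = 3 then 0 else z)" for z by (auto simp: m_def merge_def)
  have E: "blown_wheel [] n = [{0, 1}, {0, 2}, {1, 2}] @ {0, 3} # fan 3 1 2 ys"
    by (simp add: closed_strip_def cap_def ys_def del: upt_Suc)
  have i: "3 = length [{0, 1}, {0, 2}, {1, 2 :: nat}]" by simp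
  have "map m ys = ys" by (rule map_idI) (auto simp: m ys_def)
  then have "contract_edges 3 (blown_wheel [] n) = l"
    unfolding E by (subst i, subst contract_edges_nth[OF refl]) (simp add: map_fan l_def m flip: m_def)
  then have C: "contraction [] n 3 = (list_class l :: 'k gc)" by (simp add: contraction_def)
  have "z \<in> insert 0 (insert 1 (insert 2 (set ys)))" if "z \<in> \<Union>(set l)" for z
    using that fan_verts[of 0 1 2 ys] unfolding l_def by auto
  then have "inj_on f (\<Union>(set l))"
    by (intro inj_onI) (fastforce simp: f_def ys_def split: if_splits)
  from list_class_relabel[OF this] have fl: "list_class (map ((`) f) l) = (list_class l :: 'k gc)" .
  have "map f ys = [1..<n + 1]"
    by (rule nth_equalityI) (simp_all add: ys_def f_def del: upt_Suc)
  then have l: "map ((`) f) l =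
      [{n + 2, 0}, {n + 2, n + 1}, {0, n + 1}] @ fan (n + 2) 0 (n + 1) [1..<n + 1]"
    by (auto simp: l_def map_fan f_def)
  then have s: "set (map ((`) f) l) = wheel_edges (n + 2)"
    unfolding wheel_edges_fan by (simp only:)
  have "length (map ((`) f) l) = 2 * (n + 2)" by (simp add: l_def ys_def)
  also have "\<dots> = card (wheel_edges (n + 2))" using n by (simp add: wheel_edges_facts(1))
  finally have "distinct (map ((`) f) l)" using s by (intro card_distinct) simp
  moreover have "distinct (edges W)" "set (edges W) = wheel_edges (n + 2)"
    using W by (simp_all add: is_wheel_def)
  ultimately have "mset (edges W) = mset (map ((`) f) l)"
    using s set_eq_iff_mset_eq_distinct by blast
  from list_class_mset[OF this, where ?'k = 'k] show ?thesis
    by (simp add: list_class_edges C fl)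
qed

text \<open>Each edge of a wheel lies in a triangle containing the hub, so wheels are cycles. With
  \<open>gc_boundary_boundary\<close> this settles the boundary condition of
  \<open>GC_Me\<close>.\<close>

lemma gc_boundary_wheel:
  assumes N: "3 \<le> N" and W: "is_wheel N W"
  shows "\<partial> (gc_class W) = (0 :: 'k::field_char_0 gc)"
proof -
  have s: "set (edges W) = wheel_edges N" using W by (simp add: is_wheel_def)
  have rim: "{j, Suc j mod N} \<in> set (edges W)" and spoke: "{j, N} \<in> set (edges W)" if "j < N" for j
    using that by (auto simp: s wheel_edges_def)
  have lt: "Suc j mod N < N" "Suc j mod N \<noteq> j" if "j < N" for j
    using that N by (auto simp: mod_Suc)
  have ne: "Suc j mod N \<noteq> N" if "j < N" for j using lt(1)[OF that] by (rule less_imp_neq)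
  have "list_class (contract_edges i (edges W)) = (0 :: 'k gc)" if i: "i < length (edges W)" for i
  proof -
    have "edges W ! i \<in> wheel_edges N" using i s nth_mem by blast
    then obtain j where j: "j < N" and e: "edges W ! i = {j, Suc j mod N} \<or> edges W ! i = {j, N}"
      by (auto simp: wheel_edges_def)
    from e show ?thesis
    proof
      assume "edges W ! i = {j, Suc j mod N}"
      then show ?thesis
        using i spoke[OF j] spoke[OF lt(1)[OF j]] lt[OF j] ne[OF j] j
        by (intro list_class_contract_triangle[of i _ j "Suc j mod N" N]) auto
    next
      assume "edges W ! i = {j, N}"
      then show ?thesis
        using i rim[OF j] spoke[OF lt(1)[OF j]] lt[OF j] ne[OF j] j
        by (intro list_class_contract_triangle[of i _ j N "Suc j mod N"]) (auto simp: insert_commute)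
    qed
  qed
  moreover have "is_gc_graph (\<Union>(set (edges W))) (edges W)"
    using is_gc_graph_verts_edges[of W] is_gc_graph_verts by metis
  ultimately show ?thesis
    using gc_boundary_list_class[of "edges W", where ?'k = 'k] by (simp add: list_class_edges)
qed

section \<open>Telescoping over the word length\<close>

text \<open>Words are split at their last letter because \<open>contraction_hub_append\<close>
  relates \<open>w @ [x]\<close> to \<open>w\<close>.\<close>

lemma sum_words_Suc:
  "(\<Sum>w | length w = Suc L. F w) = (\<Sum>w | length w = L. F (w @ [True]) + F (w @ [False]))"
  for F :: "bool list \<Rightarrow> 'a::comm_monoid_add"
proof -
  let ?W = "\<lambda>L. {w :: bool list. length w = L}"
  have fin: "finite (?W L)" for L using finite_lists_length_eq[of "UNIV :: bool set" L] by simp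
  have "(\<Sum>w\<in>?W (Suc L). F w) = (\<Sum>(w, x)\<in>?W L \<times> UNIV. F (w @ [x]))"
    by (rule sum.reindex_bij_witness[of _ "\<lambda>(w, x). w @ [x]" "\<lambda>w. (butlast w, last w)"])
      (auto simp: append_butlast_last_id[OF length_greater_0_conv[THEN iffD1]])
  also have "\<dots> = (\<Sum>w\<in>?W L. \<Sum>x\<in>UNIV. F (w @ [x]))" by (simp add: sum.cartesian_product)
  finally show ?thesis by (simp add: UNIV_bool add.commute)
qed

lemma wheel_homologous_low_valence:
  assumes W: "is_wheel (2 * K + 5) W"
  shows "\<exists>U :: 'k::field_char_0 gc. gc_class W - \<partial> U \<in> gc.span (gc_class ` Collect low_valence)"
proof -
  interpret b: Vector_Spaces.linear gc_scale gc_scale "\<partial> :: 'k gc \<Rightarrow> 'k gc"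
    by (rule gc_boundary_linear)
  \<comment> \<open>Each letter uses up two fan vertices: from \<open>2 * K + 3\<close> for the
    empty word, which yields the wheel with \<open>2 * K + 5\<close> spokes, down to
    \<open>3\<close> at \<open>L = K\<close>.\<close>
  define n where "n L = 2 * (K - L) + 3" for L
  define V :: "nat \<Rightarrow> 'k gc" where "V L = (\<Sum>w | length w = L. list_class (blown_wheel w (n L)))" for L
  \<comment> \<open>\<open>H\<close> collects the contracted path edges at the cap, \<open>R\<close>
    the contracted outer rim edges.\<close>
  define H :: "nat \<Rightarrow> 'k gc" where
    "H L = (\<Sum>w | length w = L. contraction w (n L) (4 * length w + 3))" for L
  define R :: "nat \<Rightarrow> 'k gc" where
    "R L = (\<Sum>w | length w = L. contraction w (n L) (4 * length w + 4) +
      contraction w (n L) (4 * length w + 4 + 2 * n L))" for L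
  have dV: "\<partial> (V L) = H L - R L" for L
  proof -
    have "\<partial> (V L) = (\<Sum>w | length w = L. contraction w (n L) (4 * length w + 3) -
        (contraction w (n L) (4 * length w + 4) + contraction w (n L) (4 * length w + 4 + 2 * n L)) +
        (\<Sum>j<L. contraction w (n L) (4 * j + 3)))"
      unfolding V_def b.sum
      by (intro sum.cong refl, subst gc_boundary_blown_wheel) (auto simp: n_def)
    also have "\<dots> = H L - R L +
        (\<Sum>w | length w = L. \<Sum>j<L. contraction w (n L) (4 * j + 3))"
      by (simp add: sum.distrib sum_subtractf H_def R_def)
    also have "(\<Sum>w | length w = L. \<Sum>j<L. contraction w (n L) (4 * j + 3)) = (0 :: 'k gc)"
      by (subst sum.swap) (simp add: sum_contraction_spine)
    finally show ?thesis by simp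
  qed
  have HR: "H (Suc L) = - R L" if "L < K" for L
  proof -
    \<comment> \<open>\<open>L < K\<close> guards against the truncated subtraction in
      \<open>n\<close>.\<close>
    have nL: "n L = n (Suc L) + 2" using that by (simp add: n_def)
    have "H (Suc L) = (\<Sum>w | length w = L.
        contraction (w @ [True]) (n (Suc L)) (4 * length w + 7) +
        contraction (w @ [False]) (n (Suc L)) (4 * length w + 7))"
      unfolding H_def sum_words_Suc by (simp add: add.commute)
    also have "\<dots> = (\<Sum>w | length w = L. - (contraction w (n L) (4 * length w + 4) +
        contraction w (n L) (4 * length w + 4 + 2 * n L)))"
      unfolding contraction_hub_append nL by simp
    finally show ?thesis unfolding sum_negf R_def .
  qed
  \<comment> \<open>By \<open>HR\<close>, the term \<open>H (Suc L)\<close> cancels the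
    \<open>R L\<close> left by the preceding length, thanks to the alternating signs.\<close>
  have tele: "\<partial> (\<Sum>L\<le>J. gc_scale ((-1) ^ L) (V L)) = H 0 - gc_scale ((-1) ^ J) (R J)"
    if "J \<le> K" for J
    using that
  proof (induction J)
    case (Suc J)
    then show ?case
      using HR[of J] by (simp add: b.add b.diff b.scale dV gc.scale_right_diff_distrib gc.scale_minus_right)
  qed (simp add: dV b.scale)
  have "R K \<in> gc.span (gc_class ` Collect low_valence)"
  proof -
    have l: "contraction w 3 (if x then 4 * length w + 4 else 4 * length w + 4 + 2 * 3) \<in>
        gc.span (gc_class ` Collect low_valence :: 'k gc set)" for w x
      using contraction_rim[of 3 w x, where ?'a = 'k]
      by (simp add: list_class_low_valence valence_closed_strip_cut_cap)
    have n: "n K = 3" by (simp add: n_def)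
    show ?thesis
      unfolding R_def n
      by (intro gc.span_sum gc.span_add l[of _ True, unfolded if_True] l[of _ False, unfolded if_False])
  qed
  then have low: "gc_scale ((-1) ^ K) (R K) \<in> gc.span (gc_class ` Collect low_valence)"
    by (rule gc.span_scale)
  let ?U = "\<Sum>L\<le>K. gc_scale ((-1) ^ L) (V L)"
  have "H 0 = contraction [] (2 * K + 3) 3" by (simp add: H_def n_def)
  then have "gc_class W = H 0 \<or> gc_class W = - H 0"
    using wheel_class_contraction[of "2 * K + 3" W, where ?'k = 'k] W by (simp add: add.commute)
  then show ?thesis
  proof
    assume "gc_class W = H 0"
    then have "gc_class W - \<partial> ?U = gc_scale ((-1) ^ K) (R K)" using tele[of K] by simp
    then show ?thesis using low by metis
  next
    \<comment> \<open>The sign due to the edge order of \<open>W\<close> is absorbed by taking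
      \<open>- ?U\<close>.\<close>
    assume "gc_class W = - H 0"
    then have "gc_class W - \<partial> (- ?U) = - gc_scale ((-1) ^ K) (R K)"
      using tele[of K] by (simp add: b.neg)
    then show ?thesis using gc.span_neg[OF low] by metis
  qed
qed

lemma wheel_3_low_valence:
  assumes "is_wheel 3 W"
  shows "low_valence W"
  unfolding low_valence_def
proof
  fix v assume "v \<in> verts W"
  then have "3 \<le> valence (edges W) v"
    using is_gc_graph_verts_edges[of W] by (simp add: is_gc_graph_def)
  moreover have "valence (edges W) v \<le> 4"
  proof -
    have W: "distinct (edges W)" "set (edges W) = wheel_edges 3"
      using assms by (simp_all add: is_wheel_def)
    \<comment> \<open>The image may also contain the singleton \<open>{v}\<close>; the crude bound
      \<open>4\<close> is enough.\<close>
    have "{e \<in> set (edges W). v \<in> e} \<subseteq> (\<lambda>x. {v, x}) ` {..3}"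
    proof
      fix e assume e: "e \<in> {e \<in> set (edges W). v \<in> e}"
      then have "e \<subseteq> {..3}" "card e = 2" using wheel_edges_facts(2)[of 3 e] W by auto
      then show "e \<in> (\<lambda>x. {v, x}) ` {..3}" using e by (auto simp: card_2_iff)
    qed
    then have "card {e \<in> set (edges W). v \<in> e} \<le> card ((\<lambda>x. {v, x}) ` {..3 :: nat})"
      by (intro card_mono) auto
    also have "\<dots> \<le> 4" using card_image_le[of "{..3 :: nat}" "\<lambda>x. {v, x}"] by simp
    finally show ?thesis
      unfolding valence_def using W(1) by (metis distinct_card distinct_filter set_filter)
  qed
  ultimately show "valence (edges W) v \<in> {3, 4}" by auto
qed

text \<open>For \<open>m = 1\<close> the wheel itself has low valence and \<open>U = 0\<close>
  works; longer wheels have the form \<open>2 * K + 5\<close>. The boundary condition holds because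
  wheels are cycles and the boundary squares to zero.\<close>

theorem mainTheorem1:
  fixes d :: int and m :: nat and W :: gc_graph
  assumes "even d" and "m \<ge> 1" and "is_wheel (2 * m + 1) W"
  shows "\<exists>U :: 'k::field_char_0 gc. gc_class W - \<partial> U \<in> GC_Me"
proof -
  interpret b: Vector_Spaces.linear gc_scale gc_scale "\<partial> :: 'k gc \<Rightarrow> 'k gc"
    by (rule gc_boundary_linear)
  have "\<exists>U :: 'k gc. gc_class W - \<partial> U \<in> gc.span (gc_class ` Collect low_valence)"
  proof (cases "m = 1")
    case True
    then have "gc_class W - \<partial> 0 \<in> gc.span (gc_class ` Collect low_valence :: 'k gc set)"
      using wheel_3_low_valence[of W] assms(3) by (auto simp: b.zero intro: gc.span_base)
    then show ?thesis by blast
  next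
    case False
    define K where "K = m - 2"
    have m: "2 * m + 1 = 2 * K + 5" using False assms(2) by (simp add: K_def)
    show ?thesis by (rule wheel_homologous_low_valence) (use assms(3) in \<open>simp only: m\<close>)
  qed
  moreover have "\<partial> (gc_class W - \<partial> U) = 0" for U :: "'k gc"
    using gc_boundary_wheel[OF _ assms(3)] assms(2) by (simp add: b.diff gc_boundary_boundary)
  ultimately show ?thesis unfolding GC_Me_def by (auto simp: gc.span_zero)
qed

end
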